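(* As $n\to\infty$, $$\sigma_{od}\mathrm{moex}(n) \sim \frac{3\,e^{\pi\sqrt{n/2}}}{4\sqrt{2}\,n}.$$
   Context: For $n\ge 0$, $\mathcal{P}_{od}(n)$ is the set of all partitions of $n$ in which no odd part is repeated (even parts may appear with any multiplicity). For $\lambda\in\mathcal{P}_{od}(n)$, $\mathrm{moex}(\lambda)$ is the smallest positive odd integer that is not a part of $\lambda$. Define $\sigma_{od}\mathrm{moex}(n):=\sum_{\lambda\in\mathcal{P}_{od}(n)}\mathrm{moex}(\lambda)$. Here $f(n)\sim g(n)$ means $f(n)/g(n)\to 1$ as $n\to\infty$. *)

theory Defs
  imports Complex_Main "HOL-Library.Multiset" "HOL-Library.Landau_Symbols"
begin

text \<open>A partition is represented by the multiset of its parts.\<close>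

definition partitions_of :: "nat \<Rightarrow> nat multiset set" where
  "partitions_of n = {p. (\<forall>k \<in># p. 0 < k) \<and> sum_mset p = n}"

definition P_od :: "nat \<Rightarrow> nat multiset set" where
  "P_od n = {p \<in> partitions_of n. \<forall>k. odd k \<longrightarrow> count p k \<le> 1}"

definition moex :: "nat multiset \<Rightarrow> nat" where
  "moex p = (LEAST k. odd k \<and> k \<notin># p)"

definition sigma_od_moex :: "nat \<Rightarrow> nat" where
  "sigma_od_moex n = (\<Sum>p \<in> P_od n. moex p)"

text \<open>The sum above is not vacuous: \<open>P_od n\<close> is finite.\<close>

lemma size_le_sum_mset:
  fixes p :: "nat multiset"
  assumes "\<forall>k \<in># p. 0 < k"
  shows "size p \<le> sum_mset p"
  using assms by (induction p) auto

lemma finite_partitions_of: "finite (partitions_of n)"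
proof (rule finite_subset)
  show "partitions_of n \<subseteq> mset ` {xs. set xs \<subseteq> {..n} \<and> length xs \<le> n}"
  proof
    fix p assume p: "p \<in> partitions_of n"
    obtain xs where xs: "mset xs = p" using ex_mset by blast
    have "length xs \<le> n"
      using p size_le_sum_mset[of p] xs by (auto simp: partitions_of_def)
    moreover have "set xs \<subseteq> {..n}"
      using p xs by (auto simp: partitions_of_def sum_mset_sum_list dest: member_le_sum_list)
    ultimately show "p \<in> mset ` {xs. set xs \<subseteq> {..n} \<and> length xs \<le> n}"
      using xs by blast
  qed
  show "finite (mset ` {xs. set xs \<subseteq> {..n} \<and> length xs \<le> n})"
    by (intro finite_imageI finite_lists_length_le) simp
qed

lemma finite_P_od: "finite (P_od n)"
  by (rule finite_subset[OF _ finite_partitions_of[of n]]) (auto simp: P_od_def)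

end

theory Submission
  imports Defs "HOL-Probability.Probability" "HOL-Complex_Analysis.Complex_Analysis" "HOL-Real_Asymp.Real_Asymp"
begin

text \<open>
  Let \<open>F\<^sub>m(q) = \<Prod> q\<^bsup>2j-1\<^esup> (j \<le> m) \<cdot> \<Prod> (1 + q\<^bsup>2j-1\<^esup>) (j > m) / \<Prod> (1 - q\<^bsup>2k\<^esup>)\<close> count the
  partitions in which no odd part is repeated and all of \<open>1, 3, \<dots>, 2m-1\<close> occur. Since \<open>moex\<close> is one plus twice the
  number of \<open>m \<ge> 1\<close> for which these parts occur, the generating function of the \<open>moex\<close> sums is
  \<open>F\<^sub>0 + 2 \<Sum> F\<^sub>m (m \<ge> 1)\<close>. As \<open>q \<rightarrow> 1\<close>, \<open>F\<^sub>m / F\<^sub>0\<close> tends to \<open>2\<^bsup>-m\<^esup>\<close> and is bounded by it, so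
  this sum behaves like \<open>3 F\<^sub>0\<close>.

  With \<open>P = \<Prod> 1 / (1 - q\<^bsup>k\<^esup>)\<close> one has \<open>F\<^sub>0(q) = P(q) P(q\<^bsup>4\<^esup>) / P(q\<^bsup>2\<^esup>)\<close>. The behaviour of \<open>P(exp (-t))\<close>
  up to a factor \<open>1 + o(1)\<close> follows by dividing out the product for \<open>sinh (pi / t)\<close>: what remains is a sum
  \<open>\<Sum> f (k t)\<close> with \<open>f\<close> regular at 0, to which the trapezoidal rule applies. Comparing the steps \<open>t\<close> and \<open>t / 2\<close>
  avoids integrals, and the leading coefficient \<open>pi\<^sup>2 / 6\<close> is read off from the Lambert series of \<open>ln P\<close>.
  Hence \<open>F\<^sub>0(exp (-t)) \<sim> sqrt (t / pi) exp (pi\<^sup>2 / (8 t))\<close>.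

  The coefficients are then obtained by the saddle point method. Only the asymptotics on the real axis are needed
  near the saddle point, because Vitali's theorem transports them to complex arguments; away from it the factors of the
  product give \<open>|F\<^sub>m(q)| \<le> F\<^sub>m(|q|) exp (- |q|\<^bsup>2m+1\<^esup> (1 / (1 - |q|) - 1 / |1 - q|) / 4)\<close>.
\<close>

section \<open>The partition product on the real axis\<close>

lemma minus_ln_one_minus_bounds:
  fixes x :: real
  assumes "0 \<le> x" "x < 1"
  shows "0 \<le> - ln (1 - x)" "- ln (1 - x) \<le> x / (1 - x)"
proof -
  show "0 \<le> - ln (1 - x)" using assms by simp
  have "ln (1 / (1 - x)) \<le> 1 / (1 - x) - 1"
    using assms by (intro ln_le_minus_one) auto
  thus "- ln (1 - x) \<le> x / (1 - x)" using assms by (simp add: ln_div field_simps)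
qed

lemma minus_ln_one_minus_sums:
  fixes x :: real
  assumes "0 \<le> x" "x < 1"
  shows "(\<lambda>m. x ^ Suc m / real (Suc m)) sums (- ln (1 - x))"
proof -
  have "summable (\<lambda>m. x ^ Suc m / real (Suc m))"
  proof (rule summable_comparison_test)
    show "\<exists>N. \<forall>n\<ge>N. norm (x ^ Suc n / real (Suc n)) \<le> x * x ^ n"
    proof (intro exI allI impI)
      fix n :: nat
      have "x ^ Suc n * 1 \<le> x ^ Suc n * real (Suc n)" using assms by (intro mult_left_mono) auto
      thus "norm (x ^ Suc n / real (Suc n)) \<le> x * x ^ n" using assms by (simp add: divide_le_eq)
    qed
    show "summable (\<lambda>n. x * x ^ n)" using assms by (intro summable_mult summable_geometric) auto
  qed
  moreover have "ln (1 - x) = (\<Sum>m. - (x ^ Suc m / real (Suc m)))"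
  proof -
    have "(-1) ^ m * (1 / real (m + 1)) * (1 - x - 1) ^ Suc m = - (x ^ Suc m / real (Suc m))" for m
    proof -
      have "(1 - x - 1) ^ Suc m = (-1) ^ Suc m * x ^ Suc m" using power_minus[of x "Suc m"] by simp
      moreover have "(-1 :: real) ^ m * (-1) ^ m = 1" by (simp flip: power_mult_distrib)
      ultimately show ?thesis by (simp only:) simp
    qed
    thus ?thesis using ln_series[of "1 - x"] assms by (simp only:)
  qed
  ultimately show ?thesis by (simp add: suminf_minus summable_sums)
qed

section \<open>Logarithm of the partition product and its Lambert series\<close>

definition lnP :: "real \<Rightarrow> real" where
  "lnP t = (\<Sum>k. - ln (1 - exp (- (real (Suc k) * t))))"

lemma exp_minus_mult_eq_power: "exp (- (real k * t)) = exp (- t) ^ k"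
  by (metis exp_of_nat_mult mult_minus_right)

lemma lnP_sums:
  assumes "t > 0"
  shows "(\<lambda>k. - ln (1 - exp (- (real (Suc k) * t)))) sums lnP t"
  unfolding lnP_def
proof (rule summable_sums, rule summable_comparison_test)
  define r where "r = exp (- t)"
  have r: "0 < r" "r < 1" using assms by (auto simp: r_def)
  show "\<exists>N. \<forall>n\<ge>N. norm (- ln (1 - exp (- (real (Suc n) * t)))) \<le> (r / (1 - r)) * r ^ n"
  proof (intro exI allI impI)
    fix n :: nat
    have e: "exp (- (real (Suc n) * t)) = r ^ Suc n"
      unfolding r_def by (rule exp_minus_mult_eq_power)
    have le: "r ^ Suc n \<le> r" using r power_decreasing[of 1 "Suc n" r] by simp
    hence lt: "r ^ Suc n < 1" using r by linarith
    have "- ln (1 - r ^ Suc n) \<le> r ^ Suc n / (1 - r ^ Suc n)"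
      using r lt by (intro minus_ln_one_minus_bounds) auto
    also have "\<dots> \<le> r ^ Suc n / (1 - r)" using r le lt by (intro divide_left_mono mult_pos_pos) auto
    finally show "norm (- ln (1 - exp (- (real (Suc n) * t)))) \<le> (r / (1 - r)) * r ^ n"
      using minus_ln_one_minus_bounds(1)[of "r ^ Suc n"] r lt unfolding e by simp
  qed
  show "summable (\<lambda>n. (r / (1 - r)) * r ^ n)" using r by (intro summable_mult summable_geometric) auto
qed

text \<open>Each logarithm is expanded in powers. The double series has nonnegative terms, so the
  order of summation may be swapped, and the sum over \<open>k\<close> is then geometric.\<close>

lemma lnP_Lambert_sums:
  assumes "t > 0"
  shows "(\<lambda>m. 1 / (real (Suc m) * (exp (real (Suc m) * t) - 1))) sums lnP t"
proof -
  define f where "f = (\<lambda>(k,m). exp (- (real (Suc k) * t)) ^ Suc m / real (Suc m))"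
  have inner: "((\<lambda>m. f (k, m)) has_sum (- ln (1 - exp (- (real (Suc k) * t))))) UNIV" for k
    using minus_ln_one_minus_sums[of "exp (- (real (Suc k) * t))"] assms
    by (intro sums_nonneg_imp_has_sum) (auto simp: f_def)
  have outer: "((\<lambda>k. - ln (1 - exp (- (real (Suc k) * t)))) has_sum lnP t) UNIV"
    using lnP_sums[OF assms] assms by (intro sums_nonneg_imp_has_sum) auto
  have "f summable_on UNIV \<times> UNIV"
    by (rule summable_on_SigmaI[OF inner]) (use outer in \<open>auto simp: has_sum_imp_summable f_def\<close>)
  hence "(f has_sum lnP t) (UNIV \<times> UNIV)"
    by (intro has_sum_SigmaI[OF inner outer]) auto
  hence sw: "((\<lambda>(m,k). f (k,m)) has_sum lnP t) (UNIV \<times> UNIV)"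
    by (subst (asm) has_sum_swap)
  have inner2: "((\<lambda>k. f (k, m)) has_sum (1 / (real (Suc m) * (exp (real (Suc m) * t) - 1)))) UNIV" for m
  proof (rule sums_nonneg_imp_has_sum)
    define y where "y = exp (- (real (Suc m) * t))"
    have y: "0 < y" "y < 1" using assms by (auto simp: y_def)
    have "(\<lambda>k. (y / real (Suc m)) * y ^ k) sums ((y / real (Suc m)) * (1 / (1 - y)))"
      using y by (intro sums_mult geometric_sums) auto
    moreover have "f (k, m) = (y / real (Suc m)) * y ^ k" for k
    proof -
      have "f (k, m) = exp (- (real (Suc m) * (real (Suc k) * t))) / real (Suc m)"
        unfolding f_def by (simp only: prod.case exp_minus_mult_eq_power[symmetric])
      also have "real (Suc m) * (real (Suc k) * t) = real (Suc k) * (real (Suc m) * t)"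
        by (simp add: mult_ac)
      also have "exp (- \<dots>) = y ^ Suc k"
        unfolding y_def by (rule exp_minus_mult_eq_power)
      finally show ?thesis by simp
    qed
    moreover have "(y / real (Suc m)) * (1 / (1 - y)) = 1 / (real (Suc m) * (exp (real (Suc m) * t) - 1))"
    proof -
      have "exp (real (Suc m) * t) = 1 / y" unfolding y_def by (simp add: exp_minus inverse_eq_divide del: of_nat_Suc)
      thus ?thesis using y by (simp only:) (simp add: divide_simps)
    qed
    ultimately show "(\<lambda>k. f (k, m)) sums (1 / (real (Suc m) * (exp (real (Suc m) * t) - 1)))" by simp
  qed (auto simp: f_def)
  have "((\<lambda>m. 1 / (real (Suc m) * (exp (real (Suc m) * t) - 1))) has_sum lnP t) UNIV"
    by (rule has_sum_SigmaD[OF sw]) (use inner2 in auto)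
  thus ?thesis by (rule has_sum_imp_sums)
qed

text \<open>After multiplication by \<open>t\<close> every Lambert term tends to an inverse square
  and stays below it, because \<open>exp x - 1 \<ge> x\<close>. Tannery's theorem then yields the
  Basel sum.\<close>

lemma tendsto_mult_lnP: "((\<lambda>t. t * lnP t) \<longlongrightarrow> pi\<^sup>2 / 6) (at_right 0)"
proof -
  define a where "a = (\<lambda>m t. t / (real (Suc m) * (exp (real (Suc m) * t) - 1)))"
  have lim: "((\<lambda>t. a m t) \<longlongrightarrow> 1 / (real (m + 1))\<^sup>2) (at_right 0)" for m
  proof -
    have "((\<lambda>t. a m t) \<longlongrightarrow> inverse (1 + real m) * inverse (1 + real m)) (at_right 0)"
      unfolding a_def by real_asymp
    thus ?thesis by (simp add: power2_eq_square inverse_eq_divide add.commute)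
  qed
  have bnd: "norm (a m t) \<le> 1 / (real (m + 1))\<^sup>2" if "t > 0" for m t
  proof -
    have "real (Suc m) * t \<le> exp (real (Suc m) * t) - 1"
      using exp_ge_add_one_self[of "real (Suc m) * t"] by linarith
    hence "t / (real (Suc m) * (exp (real (Suc m) * t) - 1)) \<le> t / (real (Suc m) * (real (Suc m) * t))"
      using that by (intro divide_left_mono mult_left_mono mult_pos_pos) auto
    thus ?thesis using that by (simp add: a_def power2_eq_square)
  qed
  have ev: "eventually (\<lambda>(m, t). norm (a m t) \<le> 1 / (real (m + 1))\<^sup>2) (at_top \<times>\<^sub>F at_right 0)"
    by (rule eventually_mono[OF eventually_prodI[OF always_eventually[of "\<lambda>_. True"] eventually_at_right_less[of 0]]])
       (use bnd in auto)
  have 1: "((\<lambda>t. suminf (\<lambda>m. a m t)) \<longlongrightarrow> suminf (\<lambda>m. 1 / (real (m + 1))\<^sup>2)) (at_right 0)"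
    using tannerys_theorem[of a "\<lambda>m. 1 / (real (m + 1))\<^sup>2" "at_right 0" "\<lambda>m. 1 / (real (m + 1))\<^sup>2", OF lim ev]
      inverse_squares_sums by (simp add: sums_iff)
  have 2: "suminf (\<lambda>m. 1 / (real (m + 1))\<^sup>2) = pi\<^sup>2 / 6"
    using inverse_squares_sums by (simp add: sums_iff)
  have 3: "eventually (\<lambda>t. suminf (\<lambda>m. a m t) = t * lnP t) (at_right 0)"
    using eventually_at_right_less[of 0]
  proof eventually_elim
    case (elim t)
    from sums_mult[OF lnP_Lambert_sums[OF elim], of t] show ?case by (simp add: a_def sums_iff)
  qed
  show ?thesis using 1 unfolding 2 by (subst (asm) tendsto_cong[OF 3])
qed

lemma tendsto_exp_lnP:
  assumes "t > 0"
  shows "(\<lambda>n. \<Prod>k=1..n. 1 - exp (- t) ^ k) \<longlonglongrightarrow> exp (- lnP t)"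
proof -
  have "(\<lambda>n. exp (- (\<Sum>k<n. - ln (1 - exp (- (real (Suc k) * t)))))) \<longlonglongrightarrow> exp (- lnP t)"
    using lnP_sums[OF assms] unfolding sums_def by (intro tendsto_intros)
  also have "(\<lambda>n. exp (- (\<Sum>k<n. - ln (1 - exp (- (real (Suc k) * t))))))
      = (\<lambda>n. \<Prod>k=1..n. 1 - exp (- t) ^ k)"
  proof
    fix n
    have "exp (- (\<Sum>k<n. - ln (1 - exp (- (real (Suc k) * t)))))
        = (\<Prod>k<n. exp (ln (1 - exp (- (real (Suc k) * t)))))"
      by (simp add: sum_negf exp_sum)
    also have "\<dots> = (\<Prod>k<n. 1 - exp (- t) ^ Suc k)"
      using assms by (intro prod.cong) (auto simp: exp_minus_mult_eq_power[symmetric] simp del: power_Suc)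
    also have "\<dots> = (\<Prod>k=1..n. 1 - exp (- t) ^ k)"
      by (rule prod.reindex_bij_witness[of _ "\<lambda>k. k - 1" Suc]) auto
    finally show "exp (- (\<Sum>k<n. - ln (1 - exp (- (real (Suc k) * t))))) = (\<Prod>k=1..n. 1 - exp (- t) ^ k)" .
  qed
  finally show ?thesis .
qed

section \<open>Regularisation by the product for sinh\<close>

lemma ln_sinh_product_sums:
  assumes "t > 0"
  shows "(\<lambda>k. ln (1 + 1 / (real (Suc k) * t)\<^sup>2)) sums ln (sinh (pi / t) * t / pi)"
proof -
  \<comment> \<open>At this imaginary argument \<open>sin\<close> turns into \<open>sinh\<close>,
    and the factors of Euler's sine product become \<open>1 + 1 / (k * t)\<^sup>2\<close>.\<close>
  define z :: complex where "z = \<i> * of_real (1 / t)"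
  have z: "z \<noteq> 0" "z\<^sup>2 = - of_real ((1 / t)\<^sup>2)"
    using assms by (auto simp: z_def power_divide)
  have "(\<lambda>n. (of_real pi * z * (\<Prod>k=1..n. 1 - z^2 / of_nat k^2)) / (of_real pi * z))
          \<longlonglongrightarrow> sin (of_real pi * z) / (of_real pi * z)"
    using z by (intro tendsto_divide sin_product_formula_complex) auto
  also have "(\<lambda>n. (of_real pi * z * (\<Prod>k=1..n. 1 - z^2 / of_nat k^2)) / (of_real pi * z))
           = (\<lambda>n. of_real (\<Prod>k=1..n. 1 + 1 / (real k * t)\<^sup>2))"
    using z(1) by (simp add: z(2) field_simps power_mult_distrib)
  also have "sin (of_real pi * z) / (of_real pi * z) = of_real (sinh (pi / t) * t / pi)"
  proof -
    have "of_real pi * z = \<i> * of_real (pi / t)" by (simp add: z_def)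
    hence "sin (of_real pi * z) = \<i> * of_real (sinh (pi / t))"
      by (simp add: sin_conv_sinh sinh_field_def exp_of_real diff_divide_distrib right_diff_distrib flip: of_real_minus of_real_divide)
        (simp add: of_real_divide)
    thus ?thesis using assms by (simp add: z_def field_simps)
  qed
  finally have lim: "(\<lambda>n. \<Prod>k=1..n. 1 + 1 / (real k * t)\<^sup>2) \<longlonglongrightarrow> sinh (pi / t) * t / pi"
    by (simp only: tendsto_of_real_iff)
  have pos: "sinh (pi / t) * t / pi > 0" using assms by (intro divide_pos_pos mult_pos_pos) auto
  have "(\<lambda>n. ln (\<Prod>k=1..n. 1 + 1 / (real k * t)\<^sup>2)) \<longlonglongrightarrow> ln (sinh (pi / t) * t / pi)"
    using pos by (intro tendsto_ln lim) auto
  moreover have "ln (\<Prod>k=1..n. 1 + 1 / (real k * t)\<^sup>2) = (\<Sum>k<n. ln (1 + 1 / (real (Suc k) * t)\<^sup>2))" for n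
  proof -
    have "ln (\<Prod>k=1..n. 1 + 1 / (real k * t)\<^sup>2) = (\<Sum>k=1..n. ln (1 + 1 / (real k * t)\<^sup>2))"
      by (rule ln_prod) (auto simp: add_nonneg_eq_0_iff add_pos_nonneg)
    also have "\<dots> = (\<Sum>k<n. ln (1 + 1 / (real (Suc k) * t)\<^sup>2))"
      by (rule sum.reindex_bij_witness[of _ Suc "\<lambda>k. k - 1"]) auto
    finally show ?thesis .
  qed
  ultimately show ?thesis by (simp add: sums_def)
qed

text \<open>The summand \<open>- ln (1 - exp (- x))\<close> of \<open>lnP\<close> with its logarithmic singularity at 0 removed by the
  factors of the product for \<open>sinh\<close>, whose value is known. At \<open>x = 0\<close> the convention \<open>ln 0 = 0\<close>
  gives the correct limit value \<open>0\<close>.\<close>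
definition reg_ln :: "real \<Rightarrow> real" where
  "reg_ln x = - ln (1 - exp (- x)) + ln x - ln (1 + x\<^sup>2) / 2"

text \<open>The value of the sum of \<open>reg_ln\<close> over the positive multiples of
  \<open>t\<close>, see \<open>reg_lnP_sums\<close>. The sinh term is halved because
  \<open>ln (1 + 1 / x\<^sup>2)\<close> has twice the singularity of
  \<open>- ln (1 - exp (- x))\<close> at 0.\<close>

definition reg_lnP :: "real \<Rightarrow> real" where
  "reg_lnP t = lnP t - ln (sinh (pi / t) * t / pi) / 2"

lemma reg_ln_0 [simp]: "reg_ln 0 = 0"
  by (simp add: reg_ln_def)

lemma reg_lnP_sums:
  assumes "t > 0"
  shows "(\<lambda>k. reg_ln (real (Suc k) * t)) sums reg_lnP t"
proof -
  have "(\<lambda>k. - ln (1 - exp (- (real (Suc k) * t))) - ln (1 + 1 / (real (Suc k) * t)\<^sup>2) / 2) sums reg_lnP t"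
    unfolding reg_lnP_def by (intro sums_diff sums_divide lnP_sums ln_sinh_product_sums assms)
  moreover have "reg_ln x = - ln (1 - exp (- x)) - ln (1 + 1 / x\<^sup>2) / 2" if "x > 0" for x
  proof -
    have "1 + 1 / x\<^sup>2 = (1 + x\<^sup>2) / x\<^sup>2" using that by (simp add: field_simps)
    hence "ln (1 + 1 / x\<^sup>2) = ln (1 + x\<^sup>2) - 2 * ln x"
      using that by (simp add: ln_div ln_realpow add_nonneg_eq_0_iff)
    thus ?thesis by (simp add: reg_ln_def diff_divide_distrib)
  qed
  ultimately show ?thesis using assms by simp
qed

section \<open>Variation of the derivative of the regularised summand\<close>

definition bern :: "real \<Rightarrow> real" where
  "bern x = 1 / x - 1 / (exp x - 1)"

lemma bern_bounds:
  assumes "x > 0"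
  shows "0 \<le> bern x" "bern x \<le> 1"
proof -
  have 1: "exp x - 1 \<ge> x" using exp_ge_add_one_self[of x] by linarith
  show "0 \<le> bern x" unfolding bern_def using assms 1 by (simp add: field_simps)
  have "exp x * (1 - x) \<le> exp x * exp (- x)"
    using exp_ge_add_one_self[of "-x"] by (intro mult_left_mono) auto
  also have "\<dots> = 1" by (simp add: exp_minus)
  finally show "bern x \<le> 1" unfolding bern_def using assms 1 by (simp add: field_simps)
qed

text \<open>The derivative is nonpositive once \<open>z * exp (z / 2) \<le> exp z - 1\<close>, that
  is \<open>z / 2 \<le> sinh (z / 2)\<close>. The difference of the two sides vanishes at 0 and is
  nondecreasing.\<close>

lemma bern_antimono:
  assumes "0 < x" "x \<le> y"
  shows "bern y \<le> bern x"
proof (rule DERIV_nonpos_imp_nonincreasing[OF assms(2)])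
  fix z assume "x \<le> z" "z \<le> y"
  hence z: "z > 0" using assms by auto
  hence e: "exp z > 1" by simp
  have d: "(bern has_real_derivative (exp z / (exp z - 1)\<^sup>2 - 1 / z\<^sup>2)) (at z)"
    unfolding bern_def using z e
    by (auto intro!: derivative_eq_intros simp: power2_eq_square field_simps)
  have "exp 0 - 1 - 0 * exp (0 / 2) \<le> exp z - 1 - z * exp (z / 2)"
  proof (rule DERIV_nonneg_imp_nondecreasing[of 0 z "\<lambda>z. exp z - 1 - z * exp (z / 2)"])
    fix w :: real assume "0 \<le> w"
    have "((\<lambda>z. exp z - 1 - z * exp (z / 2)) has_real_derivative (exp w - (exp (w / 2) + w * (exp (w / 2) / 2)))) (at w)"
      by (auto intro!: derivative_eq_intros)
    moreover have "exp w - (exp (w / 2) + w * (exp (w / 2) / 2)) = exp (w / 2) * (exp (w / 2) - (1 + w / 2))"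
      by (simp add: algebra_simps flip: exp_add)
    moreover have "\<dots> \<ge> 0" by (intro mult_nonneg_nonneg) auto
    ultimately show "\<exists>D. ((\<lambda>z. exp z - 1 - z * exp (z / 2)) has_real_derivative D) (at w) \<and> 0 \<le> D" by metis
  qed (use z in auto)
  hence "z * exp (z / 2) \<le> exp z - 1" by simp
  hence "(z * exp (z / 2))\<^sup>2 \<le> (exp z - 1)\<^sup>2" using z by (intro power_mono) auto
  also have "(z * exp (z / 2))\<^sup>2 = z\<^sup>2 * exp z"
    by (simp add: power2_eq_square algebra_simps flip: exp_add)
  finally have "exp z / (exp z - 1)\<^sup>2 \<le> 1 / z\<^sup>2" using z e by (simp add: field_simps)
  thus "\<exists>D. (bern has_real_derivative D) (at z) \<and> D \<le> 0" using d by (intro exI[of _ "exp z / (exp z - 1)\<^sup>2 - 1 / z\<^sup>2"]) auto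
qed

text \<open>The derivative \<open>(1 - z\<^sup>2) / (1 + z\<^sup>2)\<^sup>2\<close> of the rational
  term is at most \<open>1 / (1 + z\<^sup>2)\<close> in absolute value, so increments of
  \<open>arctan\<close> dominate those of the rational term in either direction.\<close>

lemma arctan_pm_mono:
  assumes "x \<le> y"
  shows "arctan x - x / (1 + x\<^sup>2) \<le> arctan y - y / (1 + y\<^sup>2)"
    and "arctan x + x / (1 + x\<^sup>2) \<le> arctan y + y / (1 + y\<^sup>2)"
proof -
  have nz: "1 + z\<^sup>2 \<noteq> 0" "1 + z * z \<noteq> 0" for z :: real
    using sum_power2_eq_zero_iff[of 1 z] by (auto simp: power2_eq_square)
  have d: "((\<lambda>z. z / (1 + z\<^sup>2)) has_real_derivative ((1 - z\<^sup>2) / (1 + z\<^sup>2)\<^sup>2)) (at z)" for z :: real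
    by (auto intro!: derivative_eq_intros simp: nz) (simp add: power2_eq_square field_simps nz)
  have a: "(arctan has_real_derivative ((1 + z\<^sup>2) / (1 + z\<^sup>2)\<^sup>2)) (at z)" for z :: real
  proof -
    have "(1 + z\<^sup>2) / (1 + z\<^sup>2)\<^sup>2 = inverse (1 + z\<^sup>2)"
      using nz(1)[of z] by (simp add: power2_eq_square[of "1 + z\<^sup>2"] inverse_eq_divide)
    thus ?thesis using DERIV_arctan[of z] by simp
  qed
  show "arctan x - x / (1 + x\<^sup>2) \<le> arctan y - y / (1 + y\<^sup>2)"
    by (rule DERIV_nonneg_imp_nondecreasing[OF assms])
       (use DERIV_diff[OF a d] in \<open>force simp: diff_divide_distrib[symmetric]\<close>)
  show "arctan x + x / (1 + x\<^sup>2) \<le> arctan y + y / (1 + y\<^sup>2)"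
    by (rule DERIV_nonneg_imp_nondecreasing[OF assms])
       (use DERIV_add[OF a d] in \<open>force simp: add_divide_distrib[symmetric]\<close>)
qed

text \<open>Increments of \<open>reg_dom\<close> dominate those of the derivative of \<open>reg_ln\<close>, so the bounds on its second
  differences telescope.\<close>
definition reg_dom :: "real \<Rightarrow> real" where
  "reg_dom x = (if x \<le> 0 then -1 else arctan x - bern x)"

lemma reg_dom_bounds:
  shows "-1 \<le> reg_dom x" "reg_dom x \<le> 2"
proof -
  have "arctan x < 2" using arctan_ubound[of x] pi_less_4 by linarith
  thus "-1 \<le> reg_dom x" "reg_dom x \<le> 2" using bern_bounds[of x] by (auto simp: reg_dom_def)
       (smt (verit) zero_le_arctan_iff)+
qed

lemma reg_dom_mono: "x \<le> y \<Longrightarrow> reg_dom x \<le> reg_dom y"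
  using reg_dom_bounds[of y] bern_antimono[of x y] arctan_monotone'[of x y]
  by (auto simp: reg_dom_def)

text \<open>The poles of \<open>1 / x\<close> and \<open>1 / (exp x - 1)\<close> at 0 cancel inside
  \<open>bern\<close>, which is why the derivative stays bounded near 0.\<close>

lemma DERIV_reg_ln:
  assumes "x > 0"
  shows "(reg_ln has_real_derivative (bern x - x / (1 + x\<^sup>2))) (at x)"
proof -
  have p: "1 + x\<^sup>2 > 0" "1 + x * x > 0" by (auto simp: add_pos_nonneg)
  have e: "exp x > 1" "exp (- x) < 1" using assms by auto
  have "(reg_ln has_real_derivative (- (exp (- x) / (1 - exp (- x))) + 1 / x - x / (1 + x\<^sup>2))) (at x)"
    unfolding reg_ln_def using assms p e
    by (auto intro!: derivative_eq_intros) (simp add: divide_simps; simp add: algebra_simps)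
  moreover have "exp (- x) / (1 - exp (- x)) = 1 / (exp x - 1)"
    using e by (simp add: exp_minus field_simps)
  ultimately show ?thesis by (simp add: bern_def)
qed

lemma reg_ln_deriv_increment:
  assumes "0 < x" "x \<le> y"
  shows "\<bar>(bern y - y / (1 + y\<^sup>2)) - (bern x - x / (1 + x\<^sup>2))\<bar> \<le> reg_dom y - reg_dom x"
  using assms arctan_pm_mono[OF assms(2)] bern_antimono[OF assms]
  by (auto simp: reg_dom_def)

lemma continuous_on_reg_ln: "continuous_on {0..} reg_ln"
  unfolding continuous_on_eq_continuous_within
proof
  fix x :: real assume "x \<in> {0..}"
  show "continuous (at x within {0..}) reg_ln"
  proof (cases "x = 0")
    case True
    have "(reg_ln \<longlongrightarrow> 0) (at_right 0)"
      unfolding reg_ln_def by real_asymp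
    moreover have "at (0::real) within {0..} = at_right 0"
      by (rule at_within_nhd[of _ UNIV]) auto
    ultimately show ?thesis using True by (simp add: continuous_within)
  next
    case False
    hence "isCont reg_ln x" using DERIV_isCont[OF DERIV_reg_ln[of x]] \<open>x \<in> {0..}\<close> by auto
    thus ?thesis by (rule continuous_at_imp_continuous_at_within)
  qed
qed

lemma reg_ln_second_difference:
  assumes "0 \<le> a" "0 < h"
  shows "\<bar>reg_ln (a + h) - (reg_ln a + reg_ln (a + 2 * h)) / 2\<bar> \<le> h / 2 * (reg_dom (a + 2 * h) - reg_dom a)"
proof -
  let ?d = "\<lambda>x. bern x - x / (1 + x\<^sup>2)"
  have mvt': "\<exists>\<xi>. b < \<xi> \<and> \<xi> < b + h \<and> reg_ln (b + h) - reg_ln b = h * ?d \<xi>" if "b \<ge> 0" for b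
  proof -
    have "\<exists>\<xi>. b < \<xi> \<and> \<xi> < b + h \<and> reg_ln (b + h) - reg_ln b = (\<lambda>x. ?d \<xi> * x) (b + h - b)"
    proof (rule mvt[of b "b + h" reg_ln "\<lambda>\<xi> x. ?d \<xi> * x"])
      show "continuous_on {b..b + h} reg_ln"
        by (rule continuous_on_subset[OF continuous_on_reg_ln]) (use that in auto)
      show "(reg_ln has_derivative (\<lambda>xa. ?d x * xa)) (at x)" if "b < x" "x < b + h" for x
        using DERIV_reg_ln[of x] that \<open>b \<ge> 0\<close> by (simp add: has_field_derivative_def)
    qed (use assms in auto)
    thus ?thesis by (auto simp: mult.commute)
  qed
  obtain x where x: "a < x" "x < a + h" "reg_ln (a + h) - reg_ln a = h * ?d x"
    using mvt'[OF assms(1)] by auto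
  obtain y where y: "a + h < y" "y < a + h + h" "reg_ln (a + h + h) - reg_ln (a + h) = h * ?d y"
    using mvt'[of "a + h"] assms by auto
  have "reg_ln (a + h) - (reg_ln a + reg_ln (a + 2 * h)) / 2 = - (h / 2 * (?d y - ?d x))"
  proof -
    define c d where "c = ?d y" and "d = ?d x"
    show ?thesis using x(3) y(3) unfolding c_def[symmetric] d_def[symmetric]
      by (simp add: field_simps)
  qed
  also have "\<bar>\<dots>\<bar> = h / 2 * \<bar>?d y - ?d x\<bar>" using assms by (simp add: abs_mult)
  also have "\<dots> \<le> h / 2 * (reg_dom y - reg_dom x)"
    using x y assms by (intro mult_left_mono reg_ln_deriv_increment) auto
  also have "\<dots> \<le> h / 2 * (reg_dom (a + 2 * h) - reg_dom a)"
    using x y assms by (intro mult_left_mono diff_mono reg_dom_mono) auto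
  finally show ?thesis .
qed

text \<open>The multiples of \<open>s\<close> are the multiples of \<open>2 * s\<close> together
  with their midpoints. Replacing each midpoint value by the mean of its neighbours gives exactly
  \<open>2 * reg_lnP (2 * s)\<close>, and the errors telescope.\<close>

lemma reg_lnP_double:
  assumes "s > 0"
  shows "\<bar>reg_lnP s - 2 * reg_lnP (2 * s)\<bar> \<le> 2 * s"
proof -
  have s2: "2 * s > 0" using assms by simp
  have "(\<lambda>n. sum (\<lambda>k. reg_ln (real (Suc k) * s)) {n * 2..<n * 2 + 2}) sums reg_lnP s"
    by (rule sums_group[OF reg_lnP_sums[OF assms]]) auto
  hence 1: "(\<lambda>n. reg_ln (real n * (2 * s) + s) + reg_ln (real (Suc n) * (2 * s))) sums reg_lnP s"
    by (simp add: numeral_2_eq_2 algebra_simps)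
  \<comment> \<open>Including the index 0 costs nothing because \<open>reg_ln 0 = 0\<close>.\<close>
  have "(\<lambda>n. reg_ln (real n * (2 * s))) sums (reg_lnP (2 * s) + reg_ln (real 0 * (2 * s)))"
    using reg_lnP_sums[OF s2] by (subst (asm) sums_Suc_iff) simp
  hence 2: "(\<lambda>n. reg_ln (real n * (2 * s))) sums reg_lnP (2 * s)" by simp
  \<comment> \<open>The right neighbour is subtracted once in full, as an even multiple, and once
    with weight one half, as part of the mean; hence the coefficient \<open>3 / 2\<close>.\<close>
  have "(\<lambda>n. (reg_ln (real n * (2 * s) + s) + reg_ln (real (Suc n) * (2 * s)))
         - (reg_ln (real n * (2 * s)) + 3 * reg_ln (real (Suc n) * (2 * s))) / 2)
       sums (reg_lnP s - (reg_lnP (2 * s) + 3 * reg_lnP (2 * s)) / 2)"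
    by (intro sums_diff sums_divide sums_add sums_mult 1 2 reg_lnP_sums[OF s2])
  hence 3: "(\<lambda>n. reg_ln (real n * (2 * s) + s)
         - (reg_ln (real n * (2 * s)) + reg_ln (real n * (2 * s) + 2 * s)) / 2)
       sums (reg_lnP s - 2 * reg_lnP (2 * s))"
    by (simp add: algebra_simps add_divide_distrib)
  have "\<bar>\<Sum>n<N. reg_ln (real n * (2 * s) + s)
         - (reg_ln (real n * (2 * s)) + reg_ln (real n * (2 * s) + 2 * s)) / 2\<bar> \<le> 2 * s" for N
  proof -
    have "\<bar>\<Sum>n<N. reg_ln (real n * (2 * s) + s)
         - (reg_ln (real n * (2 * s)) + reg_ln (real n * (2 * s) + 2 * s)) / 2\<bar>
      \<le> (\<Sum>n<N. s / 2 * (reg_dom (real n * (2 * s) + 2 * s) - reg_dom (real n * (2 * s))))"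
      using assms by (intro order_trans[OF sum_abs] sum_mono reg_ln_second_difference) auto
    also have "\<dots> = s / 2 * (\<Sum>n<N. reg_dom (real (Suc n) * (2 * s)) - reg_dom (real n * (2 * s)))"
      by (simp add: sum_distrib_left algebra_simps)
    also have "\<dots> = s / 2 * (reg_dom (real N * (2 * s)) - reg_dom (real 0 * (2 * s)))"
      by (subst sum_lessThan_telescope) simp
    also have "\<dots> \<le> s / 2 * (2 - (-1))"
      using assms by (intro mult_left_mono diff_mono reg_dom_bounds) auto
    also have "\<dots> \<le> 2 * s" using assms by simp
    finally show ?thesis .
  qed
  with 3 show ?thesis unfolding sums_def
    by (intro tendsto_upperbound[OF tendsto_rabs[OF 3[unfolded sums_def]]]) (auto intro!: always_eventually)
qed

section \<open>Passage to the limit by repeated halving\<close>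

lemma tendsto_mult_reg_lnP: "((\<lambda>t. t * reg_lnP t) \<longlongrightarrow> pi\<^sup>2 / 6 - pi / 2) (at_right 0)"
proof -
  have "((\<lambda>t. t * (ln (sinh (pi / t) * t / pi) / 2)) \<longlongrightarrow> pi / 2) (at_right 0)"
    unfolding sinh_field_def by real_asymp
  from tendsto_diff[OF tendsto_mult_lnP this] show ?thesis
    by (simp add: reg_lnP_def algebra_simps)
qed

text \<open>Halving \<open>t\<close> repeatedly changes \<open>t * reg_lnP t\<close> by
  geometrically decreasing amounts, and the limit along \<open>t / 2 ^ n\<close> is known from
  \<open>tendsto_mult_reg_lnP\<close>. This identifies the main term, the integral of
  \<open>reg_ln\<close>, without computing it.\<close>

lemma reg_lnP_approx:
  assumes "t > 0"
  shows "\<bar>t * reg_lnP t - (pi\<^sup>2 / 6 - pi / 2)\<bar> \<le> t\<^sup>2"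
proof -
  define D where "D = (\<lambda>t. t * reg_lnP t)"
  have step: "\<bar>D s - D (2 * s)\<bar> \<le> 2 * s\<^sup>2" if "s > 0" for s
  proof -
    have "D s - D (2 * s) = s * (reg_lnP s - 2 * reg_lnP (2 * s))" by (simp add: D_def algebra_simps)
    hence "\<bar>D s - D (2 * s)\<bar> = s * \<bar>reg_lnP s - 2 * reg_lnP (2 * s)\<bar>" using that by (simp add: abs_mult)
    also have "\<dots> \<le> s * (2 * s)" using that by (intro mult_left_mono reg_lnP_double) auto
    finally show ?thesis by (simp add: power2_eq_square)
  qed
  \<comment> \<open>The subtracted \<open>1 / 4 ^ n\<close> makes the induction close: the next step
    costs \<open>1 / 2\<close> in units of \<open>t\<^sup>2 / 4 ^ n\<close>, while the right side
    grows by \<open>3 / 4\<close>.\<close>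
  have bound: "\<bar>D t - D (t / 2 ^ n)\<bar> \<le> t\<^sup>2 * (1 - 1 / 4 ^ n)" for n
  proof (induction n)
    case (Suc n)
    have "\<bar>D (t / 2 ^ Suc n) - D (2 * (t / 2 ^ Suc n))\<bar> \<le> 2 * (t / 2 ^ Suc n)\<^sup>2"
      using assms by (intro step) auto
    also have "(t / 2 ^ Suc n)\<^sup>2 = t\<^sup>2 / (4 * 4 ^ n)"
    proof -
      have "(2::real) ^ Suc n * 2 ^ Suc n = 4 * 4 ^ n" by (simp flip: power_mult_distrib)
      thus ?thesis by (simp only: power2_eq_square times_divide_times_eq)
    qed
    finally have "\<bar>D (t / 2 ^ Suc n) - D (t / 2 ^ n)\<bar> \<le> t\<^sup>2 / (2 * 4 ^ n)" by simp
    hence "\<bar>D t - D (t / 2 ^ Suc n)\<bar> \<le> t\<^sup>2 * (1 - 1 / 4 ^ n) + t\<^sup>2 / (2 * 4 ^ n)"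
      using Suc.IH by linarith
    also have "\<dots> \<le> t\<^sup>2 * (1 - 1 / 4 ^ Suc n)" by (simp add: field_simps)
    finally show ?case .
  qed simp
  have "filterlim (\<lambda>n. t / 2 ^ n) (at_right 0) sequentially"
    using assms by real_asymp
  hence "(\<lambda>n. D (t / 2 ^ n)) \<longlonglongrightarrow> pi\<^sup>2 / 6 - pi / 2"
    using tendsto_mult_reg_lnP unfolding D_def by (rule filterlim_compose[rotated])
  hence "(\<lambda>n. \<bar>D t - D (t / 2 ^ n)\<bar>) \<longlonglongrightarrow> \<bar>D t - (pi\<^sup>2 / 6 - pi / 2)\<bar>"
    by (intro tendsto_intros)
  moreover have "\<bar>D t - D (t / 2 ^ n)\<bar> \<le> t\<^sup>2" for n
    by (rule order_trans[OF bound mult_left_le]) auto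
  ultimately show ?thesis unfolding D_def by (intro tendsto_upperbound) (auto intro!: always_eventually)
qed

text \<open>The sinh term removed before contributes
  \<open>pi / (2 * t) + ln (t / (2 * pi)) / 2\<close> up to \<open>o(1)\<close>. Its first summand
  cancels the \<open>- pi / 2\<close> in the limit of \<open>t * reg_lnP t\<close>, and its second
  gives the square root factor.\<close>

lemma lnP_asymptotics:
  "((\<lambda>t. lnP t - pi\<^sup>2 / (6 * t) - ln (t / (2 * pi)) / 2) \<longlongrightarrow> 0) (at_right 0)"
proof -
  define R where "R = (\<lambda>t. reg_lnP t - (pi\<^sup>2 / 6 - pi / 2) / t)"
  have "(R \<longlongrightarrow> 0) (at_right 0)"
  proof (rule Lim_null_comparison)
    show "eventually (\<lambda>t. norm (R t) \<le> t) (at_right 0)"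
      using eventually_at_right_less[of 0]
    proof eventually_elim
      case (elim t)
      have "t * R t = t * reg_lnP t - (pi\<^sup>2 / 6 - pi / 2)"
        using elim unfolding R_def right_diff_distrib[of t "reg_lnP t"] by simp
      hence "\<bar>t * R t\<bar> \<le> t * t" using reg_lnP_approx[OF elim] by (simp only: power2_eq_square)
      thus ?case using elim by (simp add: abs_mult)
    qed
    show "((\<lambda>t. t) \<longlongrightarrow> 0) (at_right (0::real))" by (rule tendsto_ident_at)
  qed
  moreover have "((\<lambda>t. ln (sinh (pi / t) * t / pi) / 2 - pi / (2 * t) - ln (t / (2 * pi)) / 2) \<longlongrightarrow> 0) (at_right 0)"
    unfolding sinh_field_def by real_asymp
  ultimately have "((\<lambda>t. R t + (ln (sinh (pi / t) * t / pi) / 2 - pi / (2 * t) - ln (t / (2 * pi)) / 2)) \<longlongrightarrow> 0 + 0) (at_right 0)"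
    by (intro tendsto_add)
  moreover have "eventually (\<lambda>t. R t + (ln (sinh (pi / t) * t / pi) / 2 - pi / (2 * t) - ln (t / (2 * pi)) / 2)
        = lnP t - pi\<^sup>2 / (6 * t) - ln (t / (2 * pi)) / 2) (at_right 0)"
    using eventually_at_right_less[of 0]
    by eventually_elim (simp add: R_def reg_lnP_def field_simps)
  ultimately show ?thesis by (simp add: tendsto_cong)
qed

section \<open>A Tauberian theorem\<close>

text \<open>If convergence failed at \<open>w\<close>, some subsequence would stay away from
  \<open>g w\<close>. By Montel it has a convergent subsequence with holomorphic limit, which equals
  \<open>g\<close> on \<open>U\<close> and hence on all of \<open>S\<close> by the identity
  theorem.\<close>

lemma Vitali_convergence:
  fixes f :: "nat \<Rightarrow> complex \<Rightarrow> complex"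
  assumes S: "open S" "connected S"
    and hol: "\<And>n. f n holomorphic_on S" "g holomorphic_on S"
    and bound: "\<And>n z. z \<in> S \<Longrightarrow> norm (f n z) \<le> B"
    and U: "U \<subseteq> S" "\<xi> \<in> S" "\<xi> islimpt U"
    and lim: "\<And>z. z \<in> U \<Longrightarrow> (\<lambda>n. f n z) \<longlonglongrightarrow> g z"
    and w: "w \<in> S"
  shows "(\<lambda>n. f n w) \<longlonglongrightarrow> g w"
proof (rule ccontr)
  assume "\<not> (\<lambda>n. f n w) \<longlonglongrightarrow> g w"
  then obtain e where e: "e > 0" "\<not> eventually (\<lambda>n. dist (f n w) (g w) < e) sequentially"
    unfolding tendsto_iff by blast
  hence "infinite {n. \<not> dist (f n w) (g w) < e}"
    by (simp add: INFM_iff_infinite[symmetric] not_eventually cofinite_eq_sequentially)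
  then obtain r :: "nat \<Rightarrow> nat" where r: "strict_mono r" "\<And>n. \<not> dist (f (r n) w) (g w) < e"
    using infinite_enumerate by blast
  obtain h q where h: "h holomorphic_on S" "strict_mono q"
    "\<And>x. x \<in> S \<Longrightarrow> (\<lambda>n. (f \<circ> r) (q n) x) \<longlonglongrightarrow> h x"
  proof (rule Montel[OF S(1), of "range (f \<circ> r)" "f \<circ> r"])
    show "\<And>h. h \<in> range (f \<circ> r) \<Longrightarrow> h holomorphic_on S" using hol by auto
    show "\<exists>B. \<forall>h\<in>range (f \<circ> r). \<forall>z\<in>K. norm (h z) \<le> B" if "K \<subseteq> S" for K
      using bound that by (intro exI[of _ B]) auto
  qed (use that in auto)
  have "h z - g z = 0" if "z \<in> U" for z
  proof -
    have "(\<lambda>n. f (r (q n)) z) \<longlonglongrightarrow> g z"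
      using LIMSEQ_subseq_LIMSEQ[OF lim[OF that] strict_mono_o[OF r(1) h(2)]] by (simp add: o_def)
    moreover have "(\<lambda>n. f (r (q n)) z) \<longlonglongrightarrow> h z" using h(3) that U by auto
    ultimately show ?thesis using LIMSEQ_unique by auto
  qed
  hence "h w - g w = 0"
    by (intro analytic_continuation[of "\<lambda>z. h z - g z" S U \<xi> w] holomorphic_intros h hol S U w)
  hence "(\<lambda>n. f (r (q n)) w) \<longlonglongrightarrow> g w" using h(3)[OF w] by simp
  hence "eventually (\<lambda>n. dist (f (r (q n)) w) (g w) < e) sequentially" using e by (simp add: tendsto_iff)
  thus False using r(2) by (auto simp: eventually_sequentially)
qed

section \<open>Power series with nonnegative coefficients and their coefficient integrals\<close>

lemma integral_cis_period:
  fixes m :: int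
  shows "integrable lborel (\<lambda>x. indicator {-pi..pi} x *\<^sub>R cis (of_int m * x))"
    and "(\<integral>x. indicator {-pi..pi} x *\<^sub>R cis (of_int m * x) \<partial>lborel) = (if m = 0 then 2 * pi else 0)"
proof -
  have cont: "continuous_on {-pi..pi} (\<lambda>x. cis (of_int m * x))"
    by (intro continuous_intros)
  show "integrable lborel (\<lambda>x. indicator {-pi..pi} x *\<^sub>R cis (of_int m * x))"
    using borel_integrable_atLeastAtMost'[OF cont] by (simp add: set_integrable_def)
  show "(\<integral>x. indicator {-pi..pi} x *\<^sub>R cis (of_int m * x) \<partial>lborel) = (if m = 0 then 2 * pi else 0)"
  proof (cases "m = 0")
    case False
    have "(\<integral>x. indicator {-pi..pi} x *\<^sub>R cis (of_int m * x) \<partial>lborel)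
        = cis (of_int m * pi) / (\<i> * of_int m) - cis (of_int m * (- pi)) / (\<i> * of_int m)"
    proof (rule integral_FTC_atLeastAtMost[OF _ _ cont])
      fix x :: real
      have "((\<lambda>x. exp (\<i> * of_real (of_int m * x)) / (\<i> * of_int m)) has_vector_derivative
              exp (\<i> * of_real (of_int m * x))) (at x within {- pi..pi})"
        using False by (auto intro!: derivative_eq_intros has_vector_derivative_real_field)
          (simp add: mult.commute[of "exp _" \<i>])
      thus "((\<lambda>x. cis (of_int m * x) / (\<i> * of_int m)) has_vector_derivative cis (of_int m * x)) (at x within {- pi..pi})"
        by (simp add: cis_conv_exp)
    qed auto
    also have "cis (of_int m * (- pi)) = cis (of_int m * pi)"
      by (simp add: complex_eq_iff sin_times_pi_eq_0)
    finally show ?thesis using False by simp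
  qed (simp add: scaleR_conv_of_real)
qed

text \<open>Used both for the counts \<open>pod_count m\<close> and for the moex sums. The real sum
  \<open>rgf\<close> carries asymptotics and positivity, the complex sum \<open>cgf\<close>
  holomorphy and the coefficient integral.\<close>

locale nonneg_power_series =
  fixes s :: "nat \<Rightarrow> real"
  assumes nonneg: "0 \<le> s n"
    and summable_power: "0 \<le> r \<Longrightarrow> r < 1 \<Longrightarrow> summable (\<lambda>n. s n * r ^ n)"
begin

definition rgf :: "real \<Rightarrow> real" where
  "rgf r = (\<Sum>n. s n * r ^ n)"

definition cgf :: "complex \<Rightarrow> complex" where
  "cgf z = (\<Sum>n. of_real (s n) * z ^ n)"

lemma summable_norm_cgf: "norm z < 1 \<Longrightarrow> summable (\<lambda>n. norm (complex_of_real (s n) * z ^ n))"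
  using summable_power[of "norm z"] nonneg by (simp add: norm_mult norm_power)

lemma cgf_sums: "norm z < 1 \<Longrightarrow> (\<lambda>n. of_real (s n) * z ^ n) sums cgf z"
  unfolding cgf_def by (rule summable_sums[OF summable_norm_cancel[OF summable_norm_cgf]])

lemma cgf_of_real: "0 \<le> r \<Longrightarrow> r < 1 \<Longrightarrow> cgf (of_real r) = of_real (rgf r)"
  using cgf_sums[of "of_real r"] summable_sums[OF summable_power[of r]]
  by (auto simp: sums_iff rgf_def suminf_of_real dest!: sums_of_real[where ?'a = complex])

lemma norm_cgf_le: "norm z < 1 \<Longrightarrow> norm (cgf z) \<le> rgf (norm z)"
  unfolding cgf_def rgf_def using summable_norm[OF summable_norm_cgf[of z]] nonneg
  by (simp add: norm_mult norm_power)

lemma holomorphic_cgf: "cgf holomorphic_on ball 0 1"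
  by (rule power_series_holomorphic[where a = "\<lambda>n. of_real (s n)"]) (use cgf_sums in auto)

lemma continuous_cgf [continuous_intros]:
  assumes "continuous_on A f" "\<And>x. x \<in> A \<Longrightarrow> norm (f x) < 1"
  shows "continuous_on A (\<lambda>x. cgf (f x))"
  by (rule continuous_on_compose2[OF holomorphic_on_imp_continuous_on[OF holomorphic_cgf] assms(1)])
     (use assms(2) in auto)

text \<open>Cauchy's formula by termwise integration: the norms of the terms integrate to a
  convergent series, and orthogonality of the characters leaves only \<open>k = n\<close>.\<close>

lemma coefficient_integral:
  assumes "0 < r" "r < 1"
  shows "(\<integral>\<theta>. indicator {-pi..pi} \<theta> *\<^sub>R (cgf (of_real r * cis \<theta>) * cis (- (real n * \<theta>))) \<partial>lborel)
       = 2 * pi * s n * r ^ n"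
proof -
  define f where "f = (\<lambda>k \<theta>. (of_real (s k * r ^ k)) * (indicator {-pi..pi} \<theta> *\<^sub>R cis (of_int (int k - int n) * \<theta>)))"
  have int: "integrable lborel (f k)" for k
    unfolding f_def by (intro integrable_mult_right integral_cis_period)
  have eq: "indicator {-pi..pi} \<theta> *\<^sub>R (of_real (s k) * (of_real r * cis \<theta>) ^ k * cis (- (real n * \<theta>))) = f k \<theta>" for k \<theta>
  proof -
    have "(of_real r * cis \<theta>) ^ k * cis (- (real n * \<theta>)) = of_real (r ^ k) * (cis (real k * \<theta>) * cis (- (real n * \<theta>)))"
      by (simp only: power_mult_distrib Complex.DeMoivre mult.assoc of_real_power)
    also have "cis (real k * \<theta>) * cis (- (real n * \<theta>)) = cis (of_int (int k - int n) * \<theta>)"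
      by (simp add: cis_mult algebra_simps)
    finally show ?thesis by (simp only: f_def mult.assoc) simp
  qed
  have nrm: "norm (f k \<theta>) = indicator {-pi..pi} \<theta> * (s k * r ^ k)" for k \<theta>
    using assms nonneg by (simp add: f_def norm_mult norm_power abs_mult split: split_indicator)
  have sm: "summable (\<lambda>k. s k * r ^ k)" using summable_power assms by simp
  have "(\<lambda>k. integral\<^sup>L lborel (f k)) sums (\<integral>\<theta>. (\<Sum>k. f k \<theta>) \<partial>lborel)"
  proof (rule sums_integral[OF int])
    show "AE \<theta> in lborel. summable (\<lambda>k. norm (f k \<theta>))"
      unfolding nrm using sm by (intro AE_I2 summable_mult)
    have "(\<integral>\<theta>. norm (f k \<theta>) \<partial>lborel) = 2 * pi * (s k * r ^ k)" for k
      unfolding nrm by simp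
    thus "summable (\<lambda>k. \<integral>\<theta>. norm (f k \<theta>) \<partial>lborel)" using sm by simp
  qed
  moreover have "integral\<^sup>L lborel (f k) = (if k = n then complex_of_real (2 * pi * s n * r ^ n) else 0)" for k
    unfolding f_def integral_mult_right_zero integral_cis_period(2) by simp
  moreover have "(\<Sum>k. f k \<theta>) = indicator {-pi..pi} \<theta> *\<^sub>R (cgf (of_real r * cis \<theta>) * cis (- (real n * \<theta>)))" for \<theta>
  proof -
    have "(\<lambda>k. indicator {-pi..pi} \<theta> *\<^sub>R (of_real (s k) * (of_real r * cis \<theta>) ^ k * cis (- (real n * \<theta>))))
       sums (indicator {-pi..pi} \<theta> *\<^sub>R (cgf (of_real r * cis \<theta>) * cis (- (real n * \<theta>))))"
      using assms by (intro sums_scaleR_right sums_mult2 cgf_sums) (auto simp: norm_mult)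
    thus ?thesis unfolding eq by (simp add: sums_iff)
  qed
  ultimately have "(\<lambda>k. if k = n then complex_of_real (2 * pi * s n * r ^ n) else 0) sums
      (\<integral>\<theta>. indicator {-pi..pi} \<theta> *\<^sub>R (cgf (of_real r * cis \<theta>) * cis (- (real n * \<theta>))) \<partial>lborel)"
    by (simp only:)
  from sums_unique2[OF this sums_single] show ?thesis .
qed

text \<open>The width of the saddle point at \<open>t = sqrt (A / n)\<close> is of order \<open>t powr (3/2)\<close>. In this scale the
  quotients \<open>tilt\<close> are moment generating functions, so they are bounded in vertical strips by their values
  on the real axis, where they converge to a Gaussian; Vitali's theorem transfers this
  to the imaginary axis without any expansion of the generating function at complex arguments.\<close>

definition tilt :: "real \<Rightarrow> nat \<Rightarrow> real \<Rightarrow> complex \<Rightarrow> complex" where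
  "tilt t n d w = cgf (exp (of_real (- t) + of_real d * w)) / of_real (rgf (exp (- t))) * exp (- (of_real (real n * d) * w))"

definition rtilt :: "real \<Rightarrow> nat \<Rightarrow> real \<Rightarrow> real \<Rightarrow> real" where
  "rtilt t n d x = rgf (exp (- t + d * x)) / rgf (exp (- t)) * exp (- (real n * d * x))"

section \<open>The tilted quotients near the saddle point\<close>

lemma rgf_nonneg: "0 \<le> r \<Longrightarrow> r < 1 \<Longrightarrow> 0 \<le> rgf r"
  unfolding rgf_def by (intro suminf_nonneg summable_power mult_nonneg_nonneg nonneg) auto

lemma tilt_of_real:
  assumes "t > 0" "d * x < t"
  shows "tilt t n d (of_real x) = of_real (rtilt t n d x)"
proof -
  have 1: "exp (complex_of_real (- t) + of_real d * of_real x) = of_real (exp (- t + d * x))"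
    by (simp only: of_real_add[symmetric] of_real_mult[symmetric] exp_of_real)
  have 2: "exp (- (of_real (real n * d) * complex_of_real x)) = of_real (exp (- (real n * d * x)))"
    by (simp only: of_real_minus[symmetric] of_real_mult[symmetric] exp_of_real)
  have 3: "cgf (of_real (exp (- t + d * x))) = of_real (rgf (exp (- t + d * x)))"
    using assms by (intro cgf_of_real) auto
  show ?thesis unfolding tilt_def rtilt_def 1 2 3 by (simp only: of_real_mult of_real_divide)
qed

lemma norm_tilt_le:
  assumes "t > 0" "d * Re w < t"
  shows "norm (tilt t n d w) \<le> rtilt t n d (Re w)"
proof -
  have "norm (cgf (exp (of_real (- t) + of_real d * w))) \<le> rgf (norm (exp (of_real (- t) + of_real d * w)))"
    using assms by (intro norm_cgf_le) auto
  hence "norm (cgf (exp (of_real (- t) + of_real d * w))) \<le> rgf (exp (- t + d * Re w))" by simp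
  from divide_right_mono[OF this rgf_nonneg[of "exp (- t)"]] assms rgf_nonneg[of "exp (- t)"]
  have "norm (cgf (exp (of_real (- t) + of_real d * w))) / norm (complex_of_real (rgf (exp (- t))))
      \<le> rgf (exp (- t + d * Re w)) / rgf (exp (- t))" by simp
  from mult_right_mono[OF this, of "norm (exp (- (of_real (real n * d) * w)))"]
  show ?thesis by (simp add: tilt_def rtilt_def norm_mult norm_divide)
qed

text \<open>Each summand depends on \<open>x\<close> through \<open>exp ((k - n) * d * x)\<close>,
  whose maximum over \<open>[-1, 1]\<close> is attained at an endpoint; the sum of both endpoint
  values covers either sign of \<open>k - n\<close>.\<close>

lemma rtilt_le:
  assumes "t > 0" "0 \<le> d" "d < t" "\<bar>x\<bar> \<le> 1"
  shows "rtilt t n d x \<le> rtilt t n d 1 + rtilt t n d (-1)"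
proof -
  have dx: "\<bar>d * y\<bar> < t" if "\<bar>y\<bar> \<le> 1" for y
    using assms that mult_left_le[of "\<bar>y\<bar>" d] by (simp add: abs_mult)
  have sums: "(\<lambda>k. s k * (exp (- t) ^ k * exp ((real k - real n) * d * y))) sums (rgf (exp (- t + d * y)) * exp (- (real n * d * y)))"
    if "\<bar>y\<bar> \<le> 1" for y
  proof -
    have "(\<lambda>k. s k * exp (- t + d * y) ^ k * exp (- (real n * d * y))) sums (rgf (exp (- t + d * y)) * exp (- (real n * d * y)))"
      unfolding rgf_def using dx[OF that] by (intro sums_mult2 summable_sums summable_power) auto
    moreover have "s k * exp (- t + d * y) ^ k * exp (- (real n * d * y)) = s k * (exp (- t) ^ k * exp ((real k - real n) * d * y))" for k
    proof -
      have "real k * (- t + d * y) + - (real n * d * y) = real k * (- t) + (real k - real n) * d * y"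
        by (simp add: algebra_simps)
      hence "exp (- t + d * y) ^ k * exp (- (real n * d * y)) = exp (- t) ^ k * exp ((real k - real n) * d * y)"
        by (simp only: exp_of_nat_mult[symmetric] exp_add[symmetric])
      thus ?thesis by (simp only: mult.assoc)
    qed
    ultimately show ?thesis by (simp only:)
  qed
  have "exp ((real k - real n) * d * x) \<le> exp ((real k - real n) * d * 1) + exp ((real k - real n) * d * (-1))" for k
  proof -
    define a where "a = (real k - real n) * d"
    have "a * x \<le> \<bar>a * x\<bar>" by (rule abs_ge_self)
    also have "\<dots> \<le> \<bar>a\<bar> * 1" unfolding abs_mult using assms(4) by (intro mult_left_mono) auto
    finally have "a * x \<le> \<bar>a\<bar>" by simp
    hence "exp (a * x) \<le> exp \<bar>a\<bar>" by simp
    also have "\<dots> \<le> exp (a * 1) + exp (a * (-1))" by (cases "a \<ge> 0") simp_all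
    finally show ?thesis by (simp only: a_def)
  qed
  hence "s k * (exp (- t) ^ k * exp ((real k - real n) * d * x)) \<le>
     s k * (exp (- t) ^ k * (exp ((real k - real n) * d * 1) + exp ((real k - real n) * d * (-1))))" for k
    by (intro mult_left_mono nonneg zero_le_power exp_ge_zero)
  hence le: "s k * (exp (- t) ^ k * exp ((real k - real n) * d * x)) \<le>
     s k * (exp (- t) ^ k * exp ((real k - real n) * d * 1)) + s k * (exp (- t) ^ k * exp ((real k - real n) * d * (-1)))" for k
    unfolding distrib_left .
  have "rgf (exp (- t + d * x)) * exp (- (real n * d * x))
      \<le> rgf (exp (- t + d * 1)) * exp (- (real n * d * 1)) + rgf (exp (- t + d * (-1))) * exp (- (real n * d * (-1)))"
    using assms(4) by (intro sums_le[OF le sums sums_add[OF sums sums]]) (simp_all only: abs_minus_cancel abs_1 order_refl)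
  hence "(rgf (exp (- t + d * x)) * exp (- (real n * d * x))) / rgf (exp (- t))
      \<le> (rgf (exp (- t + d * 1)) * exp (- (real n * d * 1)) + rgf (exp (- t + d * (-1))) * exp (- (real n * d * (-1)))) / rgf (exp (- t))"
    using assms by (intro divide_right_mono rgf_nonneg) auto
  thus ?thesis by (simp only: rtilt_def add_divide_distrib times_divide_eq_left)
qed

text \<open>At the saddle point \<open>n = A / t\<^sup>2\<close>. The shifted parameter is
  \<open>t * y t\<close> with \<open>y t \<longlongrightarrow> 1\<close>, so the assumed asymptotics
  apply to numerator and denominator alike and only the exponents remain to be compared.\<close>

lemma tendsto_rtilt:
  assumes A: "A > 0" and K: "K > 0"
    and asym: "((\<lambda>t. rgf (exp (- t)) / (K * sqrt t * exp (A / t))) \<longlongrightarrow> 1) (at_right 0)"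
  shows "(\<lambda>n. let t = sqrt (A / real n) in rtilt t n (t * sqrt t) x) \<longlonglongrightarrow> exp (A * x\<^sup>2)"
proof -
  define Q where "Q = (\<lambda>t. rgf (exp (- t)) / (K * sqrt t * exp (A / t)))"
  define y where "y = (\<lambda>t. 1 - sqrt t * x)"
  have tn: "filterlim (\<lambda>n. sqrt (A / real n)) (at_right 0) sequentially"
    using A by real_asymp
  have y1: "(y \<longlongrightarrow> 1) (at_right 0)"
  proof -
    have "(y \<longlongrightarrow> 1 - sqrt 0 * x) (at_right 0)" unfolding y_def by (intro tendsto_intros)
    thus ?thesis by simp
  qed
  have ypos: "eventually (\<lambda>t. y t > 0) (at_right 0)"
    using order_tendstoD(1)[OF y1, of 0] by simp
  have ty: "filterlim (\<lambda>t. t * y t) (at_right 0) (at_right 0)"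
    unfolding filterlim_at
  proof
    show "\<forall>\<^sub>F t in at_right 0. t * y t \<in> {0<..} \<and> t * y t \<noteq> 0"
      using ypos eventually_at_right_less[of 0] by eventually_elim auto
    have "((\<lambda>t. t * y t) \<longlongrightarrow> 0 * 1) (at_right 0)" by (intro tendsto_mult y1 tendsto_ident_at)
    thus "((\<lambda>t. t * y t) \<longlongrightarrow> 0) (at_right 0)" by simp
  qed
  have "((\<lambda>t. Q (t * y t) / Q t * sqrt (y t) * exp (A * x\<^sup>2 / y t)) \<longlongrightarrow> 1 / 1 * sqrt 1 * exp (A * x\<^sup>2 / 1)) (at_right 0)"
    using asym by (intro tendsto_intros y1 filterlim_compose[OF _ ty]) (auto simp: Q_def)
  hence lim: "((\<lambda>t. Q (t * y t) / Q t * sqrt (y t) * exp (A * x\<^sup>2 / y t)) \<longlongrightarrow> exp (A * x\<^sup>2)) (at_right 0)" by simp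
  have ev: "eventually (\<lambda>t. Q (t * y t) / Q t * sqrt (y t) * exp (A * x\<^sup>2 / y t)
      = rgf (exp (- t + t * sqrt t * x)) / rgf (exp (- t)) * exp (- (A / t\<^sup>2 * (t * sqrt t) * x))) (at_right 0)"
    using ypos eventually_at_right_less[of 0]
  proof eventually_elim
    case (elim t)
    have e1: "t * y t = t - t * sqrt t * x" by (simp add: y_def algebra_simps)
    \<comment> \<open>An exact identity: the part of \<open>A / (t * y t) - A / t\<close> that is
      linear in \<open>x\<close> is removed by the tilting factor, and the quadratic remainder is
      the Gaussian exponent.\<close>
    have e2: "A * x\<^sup>2 / y t = A / (t * y t) - A / t - A / t\<^sup>2 * (t * sqrt t) * x"
    proof -
      have "sqrt t * sqrt t = t" using elim by simp
      hence "x\<^sup>2 * t = 1 - y t - y t * (sqrt t * x)"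
        by (simp add: y_def power2_eq_square algebra_simps)
      moreover have "A * x\<^sup>2 / y t = A * (x\<^sup>2 * t) / (t * y t)" using elim by simp
      ultimately have "A * x\<^sup>2 / y t = A * (1 - y t - y t * (sqrt t * x)) / (t * y t)" by (simp only:)
      also have "\<dots> = A / (t * y t) - A * y t / (t * y t) - A * y t * (sqrt t * x) / (t * y t)"
        by (simp only: right_diff_distrib diff_divide_distrib mult_1_right mult.assoc)
      also have "A * y t / (t * y t) = A / t" using elim by simp
      also have "A * y t * (sqrt t * x) / (t * y t) = A / t\<^sup>2 * (t * sqrt t) * x"
        using elim by (simp add: power2_eq_square)
      finally show ?thesis .
    qed
    have "Q (t * y t) / Q t * sqrt (y t) * exp (A * x\<^sup>2 / y t)
      = rgf (exp (- (t * y t))) / rgf (exp (- t)) * (exp (A / t) / exp (A / (t * y t)) * exp (A * x\<^sup>2 / y t))"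
    proof -
      have "Q (t * y t) / Q t * sqrt (y t) = rgf (exp (- (t * y t))) / rgf (exp (- t)) * (exp (A / t) / exp (A / (t * y t)))
         * ((K * sqrt t) / (K * sqrt (t * y t)) * sqrt (y t))"
        by (simp only: Q_def divide_divide_eq_left divide_divide_eq_right times_divide_times_eq times_divide_eq_left times_divide_eq_right mult_ac)
      moreover have "(K * sqrt t) / (K * sqrt (t * y t)) * sqrt (y t) = 1"
        using elim K by (simp add: real_sqrt_mult)
      ultimately show ?thesis by (simp only: mult_1_right mult.assoc)
    qed
    also have "exp (A / t) / exp (A / (t * y t)) * exp (A * x\<^sup>2 / y t) = exp (- (A / t\<^sup>2 * (t * sqrt t) * x))"
      unfolding e2 exp_diff[symmetric] exp_add[symmetric] by simp
    finally show ?case unfolding e1 by (simp add: algebra_simps)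
  qed
  have "(\<lambda>n. (\<lambda>t. rgf (exp (- t + t * sqrt t * x)) / rgf (exp (- t)) * exp (- (A / t\<^sup>2 * (t * sqrt t) * x))) (sqrt (A / real n)))
     \<longlonglongrightarrow> exp (A * x\<^sup>2)"
    by (rule filterlim_compose[OF lim[unfolded tendsto_cong[OF ev]] tn])
  moreover have "eventually (\<lambda>n. (\<lambda>t. rgf (exp (- t + t * sqrt t * x)) / rgf (exp (- t)) * exp (- (A / t\<^sup>2 * (t * sqrt t) * x))) (sqrt (A / real n))
      = (let t = sqrt (A / real n) in rtilt t n (t * sqrt t) x)) sequentially"
    using eventually_gt_at_top[of 0] by eventually_elim (use A in \<open>simp add: rtilt_def Let_def\<close>)
  ultimately show ?thesis by (rule Lim_transform_eventually)
qed

text \<open>The coefficient integral over the circle of radius \<open>exp (- t)\<close> after the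
  substitution \<open>\<theta> = d * u\<close>, normalised by the value on the positive
  axis.\<close>

lemma coefficient_eq_integral_tilt:
  assumes "t > 0" "d > 0" "rgf (exp (- t)) > 0"
  shows "(\<integral>u. indicator {-(pi / d)..pi / d} u *\<^sub>R tilt t n d (\<i> * of_real u) \<partial>lborel)
       = of_real (2 * pi * s n * exp (- t) ^ n / (d * rgf (exp (- t))))"
proof -
  define F where "F = (\<lambda>\<theta>. indicator {-pi..pi} \<theta> *\<^sub>R (cgf (of_real (exp (- t)) * cis \<theta>) * cis (- (real n * \<theta>))))"
  have "integral\<^sup>L lborel F = \<bar>d\<bar> *\<^sub>R (\<integral>u. F (0 + d * u) \<partial>lborel)"
    using assms by (intro lborel_integral_real_affine) auto
  moreover have "F (0 + d * u) = of_real (rgf (exp (- t))) * (indicator {-(pi / d)..pi / d} u *\<^sub>R tilt t n d (\<i> * of_real u))" for u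
  proof -
    have "indicator {-pi..pi} (d * u) = (indicator {-(pi / d)..pi / d} u :: real)"
      using assms by (auto simp: field_simps split: split_indicator)
    moreover have "of_real (exp (- t)) * cis (d * u) = exp (of_real (- t) + of_real d * (\<i> * of_real u))"
      by (simp add: cis_conv_exp exp_add mult_ac flip: exp_of_real of_real_minus)
    moreover have "cis (- (real n * (d * u))) = exp (- (of_real (real n * d) * (\<i> * of_real u)))"
      by (simp add: cis_conv_exp mult_ac)
    ultimately show ?thesis using assms by (simp add: F_def tilt_def)
  qed
  ultimately have "integral\<^sup>L lborel F = of_real d * (of_real (rgf (exp (- t))) * (\<integral>u. indicator {-(pi / d)..pi / d} u *\<^sub>R tilt t n d (\<i> * of_real u) \<partial>lborel))"
    using assms by (simp add: scaleR_conv_of_real)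
  moreover have "integral\<^sup>L lborel F = 2 * pi * s n * exp (- t) ^ n"
    unfolding F_def using coefficient_integral[of "exp (- t)" n] assms by simp
  ultimately show ?thesis using assms by (simp add: field_simps)
qed

end

section \<open>The saddle point argument\<close>

lemma integral_gaussian:
  assumes "A > 0"
  shows "integrable lborel (\<lambda>x. exp (- A * x\<^sup>2))" "(\<integral>x. exp (- A * x\<^sup>2) \<partial>lborel) = sqrt (pi / A)"
proof -
  define \<sigma> where "\<sigma> = sqrt (1 / (2 * A))"
  have \<sigma>: "\<sigma>\<^sup>2 = 1 / (2 * A)" using assms by (simp add: \<sigma>_def)
  have eq: "exp (- A * x\<^sup>2) = sqrt (pi / A) * normal_density 0 \<sigma> x" for x
  proof -
    have "sqrt (2 * pi * \<sigma>\<^sup>2) = sqrt (pi / A)" by (simp add: \<sigma>)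
    moreover have "- (x - 0)\<^sup>2 / (2 * \<sigma>\<^sup>2) = - A * x\<^sup>2" using assms by (simp add: \<sigma>)
    ultimately show ?thesis using assms unfolding normal_density_def by simp
  qed
  have "\<sigma> > 0" using assms by (simp add: \<sigma>_def)
  thus "integrable lborel (\<lambda>x. exp (- A * x\<^sup>2))" unfolding eq by simp
  show "(\<integral>x. exp (- A * x\<^sup>2) \<partial>lborel) = sqrt (pi / A)" unfolding eq using \<open>\<sigma> > 0\<close> by simp
qed

text \<open>Ingham's Tauberian theorem in the case of an exponent \<open>A / t\<close>, with the monotonicity of the coefficients
  replaced by a bound on the generating function off the real axis.\<close>
theorem (in nonneg_power_series) coefficient_asymptotics:
  assumes A: "A > 0" and K: "K > 0" and t0: "t0 > 0"
    and asym: "((\<lambda>t. rgf (exp (- t)) / (K * sqrt t * exp (A / t))) \<longlongrightarrow> 1) (at_right 0)"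
    and bound: "\<And>t \<theta>. 0 < t \<Longrightarrow> t < t0 \<Longrightarrow> \<bar>\<theta>\<bar> \<le> pi \<Longrightarrow>
        norm (cgf (exp (of_real (- t) + \<i> * of_real \<theta>))) \<le> C * rgf (exp (- t)) / (1 + \<theta>\<^sup>2 / t ^ 3)"
  shows "s \<sim>[at_top] (\<lambda>n. K * sqrt (A / pi) / (2 * real n) * exp (2 * sqrt (A * real n)))"
proof -
  define t where "t = (\<lambda>n. sqrt (A / real n))"
  define d where "d = (\<lambda>n. t n * sqrt (t n))"
  have tn: "filterlim t (at_right 0) sequentially"
    unfolding t_def using A by real_asymp
  \<comment> \<open>These conditions hold for all large \<open>n\<close>, and \<open>t < 1\<close>
    gives \<open>d n < t n\<close>. The sequences are later shifted by \<open>N\<close> because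
    Vitali's theorem asks for its hypotheses at every index.\<close>
  have "eventually (\<lambda>t. 0 < t \<and> t < t0 \<and> t < 1 \<and> rgf (exp (- t)) > 0) (at_right 0)"
  proof -
    have "eventually (\<lambda>t. rgf (exp (- t)) / (K * sqrt t * exp (A / t)) > 0) (at_right 0)"
      using order_tendstoD(1)[OF asym, of 0] by simp
    moreover have "eventually (\<lambda>t::real. t < min t0 1) (at_right 0)"
      using t0 eventually_at_right_real[of 0 "min t0 1"] by (auto elim!: eventually_mono)
    ultimately show ?thesis using eventually_at_right_less[of 0]
    proof eventually_elim
      case (elim t)
      thus ?case using rgf_nonneg[of "exp (- t)"] by (auto simp: zero_less_divide_iff)
    qed
  qed
  from filterlim_iff[THEN iffD1, OF tn, rule_format, OF this]
  obtain N where N: "\<And>n. n \<ge> N \<Longrightarrow> 0 < t n \<and> t n < t0 \<and> t n < 1 \<and> rgf (exp (- t n)) > 0"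
    by (auto simp: eventually_sequentially)
  have d: "0 < d n" "d n < t n" if "n \<ge> N" for n
  proof -
    show "0 < d n" using N[OF that] by (simp add: d_def)
    have "t n * sqrt (t n) < t n * 1" using N[OF that] by (intro mult_strict_left_mono) auto
    thus "d n < t n" by (simp add: d_def)
  qed
  define H where "H = (\<lambda>n w. tilt (t n) n (d n) w)"
  have rlim: "(\<lambda>n. rtilt (t n) n (d n) x) \<longlonglongrightarrow> exp (A * x\<^sup>2)" for x
    using tendsto_rtilt[OF A K asym, of x] by (simp add: t_def d_def Let_def)
  \<comment> \<open>In this strip \<open>d n * Re w < t n\<close> for \<open>n \<ge> N\<close>, so
    the argument of \<open>cgf\<close> stays inside the unit disc.\<close>
  define S where "S = {w :: complex. \<bar>Re w\<bar> < 1}"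
  have S_eq: "S = {w. Re w < 1} \<inter> {w. Re w > -1}" by (auto simp: S_def)
  have S: "open S" "connected S"
    unfolding S_eq by (intro open_Int open_halfspace_Re_lt open_halfspace_Re_gt convex_connected
        convex_Int convex_halfspace_Re_lt convex_halfspace_Re_gt)+
  have dS: "d n * Re w < t n" if "n \<ge> N" "\<bar>Re w\<bar> \<le> 1" for n w
  proof -
    have "d n * Re w \<le> d n * 1" using d[OF that(1)] that(2) by (intro mult_left_mono) auto
    also have "\<dots> < t n" using d[OF that(1)] by simp
    finally show ?thesis .
  qed
  have Hlim: "(\<lambda>n. H (n + N) w) \<longlonglongrightarrow> exp (of_real A * w\<^sup>2)" if w: "w \<in> S" for w
  proof -
    \<comment> \<open>The real quotients converge at 1 and -1, hence are bounded there, and by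
      \<open>rtilt_le\<close> these two points control the whole strip.\<close>
    obtain B where B: "\<And>n. rtilt (t n) n (d n) 1 + rtilt (t n) n (d n) (-1) \<le> B"
    proof -
      have "Bseq (\<lambda>n. rtilt (t n) n (d n) 1 + rtilt (t n) n (d n) (-1))"
        by (rule convergent_imp_Bseq[OF convergentI[OF tendsto_add[OF rlim rlim]]])
      thus ?thesis using that unfolding Bseq_def by (metis abs_ge_self order_trans real_norm_def)
    qed
    show ?thesis
    proof (rule Vitali_convergence[where f = "\<lambda>n. H (n + N)" and g = "\<lambda>w. exp (of_real A * w\<^sup>2)"
          and B = B and U = "of_real ` {-1<..<1}" and \<xi> = 0, OF S])
      show "H (n + N) holomorphic_on S" for n
        unfolding H_def tilt_def using N[of "n + N"] dS[of "n + N"]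
        by (intro holomorphic_intros holomorphic_on_compose_gen[OF _ holomorphic_cgf, unfolded o_def])
           (auto simp: S_def)
      show "norm (H (n + N) z) \<le> B" if "z \<in> S" for n z
      proof -
        have "norm (H (n + N) z) \<le> rtilt (t (n + N)) (n + N) (d (n + N)) (Re z)"
          unfolding H_def using N[of "n + N"] dS[of "n + N" z] that by (intro norm_tilt_le) (auto simp: S_def)
        also have "\<dots> \<le> rtilt (t (n + N)) (n + N) (d (n + N)) 1 + rtilt (t (n + N)) (n + N) (d (n + N)) (-1)"
          using N[of "n + N"] d[of "n + N"] that by (intro rtilt_le) (auto simp: S_def)
        also have "\<dots> \<le> B" by (rule B)
        finally show ?thesis .
      qed
      show "(\<lambda>n. H (n + N) z) \<longlonglongrightarrow> exp (of_real A * z\<^sup>2)" if "z \<in> of_real ` {-1<..<1}" for z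
      proof -
        from that obtain x where x: "z = of_real x" "\<bar>x\<bar> < 1" by auto
        have "(\<lambda>n. complex_of_real (rtilt (t (n + N)) (n + N) (d (n + N)) x)) \<longlonglongrightarrow> of_real (exp (A * x\<^sup>2))"
          by (intro tendsto_of_real LIMSEQ_ignore_initial_segment[OF rlim])
        moreover have "H (n + N) z = of_real (rtilt (t (n + N)) (n + N) (d (n + N)) x)" for n
          unfolding H_def x(1) using N[of "n + N"] dS[of "n + N" "of_real x"] x(2) by (intro tilt_of_real) auto
        ultimately show ?thesis by (simp add: x(1) flip: exp_of_real)
      qed
      show "(0::complex) islimpt of_real ` {-1<..<1}"
        unfolding islimpt_approachable
      proof (intro allI impI)
        fix e :: real assume "e > 0"
        thus "\<exists>x'\<in>complex_of_real ` {-1<..<1}. x' \<noteq> 0 \<and> dist x' 0 < e"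
          by (intro bexI[of _ "of_real (min (e / 2) (1 / 2))"]) (auto simp: min_def)
      qed
    qed (use w in \<open>auto simp: S_def intro!: holomorphic_intros\<close>)
  qed
  define W where "W = (\<lambda>n u. indicator {-(pi / d n)..pi / d n} u *\<^sub>R H n (\<i> * of_real u))"
  have "(\<lambda>n. integral\<^sup>L lborel (W (n + N))) \<longlonglongrightarrow> integral\<^sup>L lborel (\<lambda>u. complex_of_real (exp (- A * u\<^sup>2)))"
  proof (rule integral_dominated_convergence[where w = "\<lambda>u. C * inverse (1 + u\<^sup>2)"])
    show "integrable lborel (\<lambda>u. C * inverse (1 + u\<^sup>2) :: real)"
      using integrable_inverse_1_plus_square by (intro integrable_mult_right) (simp add: set_integrable_def)
    show "W (n + N) \<in> borel_measurable lborel" for n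
    proof -
      have "continuous_on UNIV (\<lambda>u. H (n + N) (\<i> * of_real u))"
        unfolding H_def tilt_def using N[of "n + N"] by (intro continuous_intros) auto
      hence "(\<lambda>u. H (n + N) (\<i> * of_real u)) \<in> borel_measurable borel"
        by (rule borel_measurable_continuous_onI)
      thus ?thesis unfolding W_def by simp
    qed
    show "AE u in lborel. norm (W (n + N) u) \<le> C * inverse (1 + u\<^sup>2)" for n
    proof (rule AE_I2)
      fix u :: real
      let ?m = "n + N"
      have m: "0 < t ?m" "t ?m < t0" "rgf (exp (- t ?m)) > 0" "0 < d ?m" using N[of ?m] d[of ?m] by auto
      \<comment> \<open>The decay hypothesis at \<theta> = 0 forces this sign; it is needed where
        \<open>W\<close> vanishes.\<close>
      have C: "0 \<le> C"
      proof -
        have "norm (cgf (exp (of_real (- t ?m) + \<i> * of_real 0))) \<le> C * rgf (exp (- t ?m)) / (1 + 0\<^sup>2 / t ?m ^ 3)"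
          using m by (intro bound) auto
        from order_trans[OF norm_ge_zero this] have "0 \<le> C * rgf (exp (- t ?m))" by simp
        thus ?thesis using m by (simp add: zero_le_mult_iff)
      qed
      show "norm (W ?m u) \<le> C * inverse (1 + u\<^sup>2)"
      proof (cases "\<bar>u\<bar> \<le> pi / d ?m")
        case True
        have du: "\<bar>d ?m * u\<bar> \<le> pi" using True m by (simp add: abs_mult field_simps)
        \<comment> \<open>Since \<open>d\<^sup>2 = t ^ 3\<close>, the decay hypothesis at
          \<open>\<theta> = d * u\<close> turns into the fixed integrable majorant
          \<open>C / (1 + u\<^sup>2)\<close>.\<close>
        have "(d ?m * u)\<^sup>2 = (t ?m)\<^sup>2 * t ?m * u\<^sup>2"
          using m by (simp add: d_def power_mult_distrib)
        also have "\<dots> = t ?m ^ 3 * u\<^sup>2" by (simp add: power3_eq_cube power2_eq_square)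
        finally have "(d ?m * u)\<^sup>2 / t ?m ^ 3 = u\<^sup>2" using m by simp
        hence "norm (cgf (exp (of_real (- t ?m) + \<i> * of_real (d ?m * u)))) \<le> C * rgf (exp (- t ?m)) / (1 + u\<^sup>2)"
          using bound[OF m(1,2) du] by simp
        hence "norm (cgf (exp (of_real (- t ?m) + of_real (d ?m) * (\<i> * of_real u)))) / rgf (exp (- t ?m)) \<le> C / (1 + u\<^sup>2)"
          using m by (simp add: divide_le_eq mult_ac)
        moreover have "u \<in> {-(pi / d ?m)..pi / d ?m}" using True by (auto simp: abs_le_iff)
        ultimately show ?thesis using m
          by (simp add: W_def H_def tilt_def norm_mult norm_divide inverse_eq_divide)
      next
        case False
        hence "u \<notin> {-(pi / d ?m)..pi / d ?m}" by (auto simp: abs_le_iff)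
        thus ?thesis using C by (simp add: W_def)
      qed
    qed
    show "AE u in lborel. (\<lambda>n. W (n + N) u) \<longlonglongrightarrow> complex_of_real (exp (- A * u\<^sup>2))"
    proof (rule AE_I2)
      fix u :: real
      \<comment> \<open>The range of integration exhausts the line because \<open>d n\<close> tends
        to 0.\<close>
      have "eventually (\<lambda>t::real. \<bar>u\<bar> \<le> pi / (t * sqrt t)) (at_right 0)"
        by real_asymp
      from filterlim_iff[THEN iffD1, OF tn, rule_format, OF this]
      have ev: "eventually (\<lambda>n. \<bar>u\<bar> \<le> pi / d (n + N)) sequentially"
        unfolding d_def by (rule sequentially_offset)
      have "(\<lambda>n. H (n + N) (\<i> * of_real u)) \<longlonglongrightarrow> exp (of_real A * (\<i> * of_real u)\<^sup>2)"
        by (rule Hlim) (simp add: S_def)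
      also have "exp (of_real A * (\<i> * of_real u)\<^sup>2) = complex_of_real (exp (- A * u\<^sup>2))"
        by (simp add: power_mult_distrib flip: exp_of_real)
      finally show "(\<lambda>n. W (n + N) u) \<longlonglongrightarrow> complex_of_real (exp (- A * u\<^sup>2))"
        by (rule Lim_transform_eventually)
           (use ev in \<open>auto elim!: eventually_mono simp: W_def abs_le_iff\<close>)
    qed
  qed auto
  moreover have "integral\<^sup>L lborel (W (n + N)) = of_real (2 * pi * s (n + N) * exp (- t (n + N)) ^ (n + N) / (d (n + N) * rgf (exp (- t (n + N)))))" for n
    unfolding W_def H_def using N[of "n + N"] d[of "n + N"] by (intro coefficient_eq_integral_tilt) auto
  moreover have "integral\<^sup>L lborel (\<lambda>u. complex_of_real (exp (- A * u\<^sup>2))) = of_real (sqrt (pi / A))"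
    using integral_gaussian[OF A] by simp
  ultimately have "(\<lambda>n. complex_of_real (2 * pi * s (n + N) * exp (- t (n + N)) ^ (n + N) / (d (n + N) * rgf (exp (- t (n + N))))))
        \<longlonglongrightarrow> of_real (sqrt (pi / A))" by (simp only:)
  hence "(\<lambda>n. 2 * pi * s (n + N) * exp (- t (n + N)) ^ (n + N) / (d (n + N) * rgf (exp (- t (n + N))))) \<longlonglongrightarrow> sqrt (pi / A)"
    by (simp only: tendsto_of_real_iff)
  hence lim1: "(\<lambda>n. 2 * pi * s n * exp (- t n) ^ n / (d n * rgf (exp (- t n)))) \<longlonglongrightarrow> sqrt (pi / A)"
    by (rule LIMSEQ_offset)
  have lim2: "(\<lambda>n. rgf (exp (- t n)) / (K * sqrt (t n) * exp (A / t n))) \<longlonglongrightarrow> 1"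
    by (rule filterlim_compose[OF asym tn])
  \<comment> \<open>The second factor trades the exact value of the generating function for its
    asymptotic form; the third normalises the limit to 1.\<close>
  have "(\<lambda>n. 2 * pi * s n * exp (- t n) ^ n / (d n * rgf (exp (- t n))) *
        (rgf (exp (- t n)) / (K * sqrt (t n) * exp (A / t n))) * (1 / sqrt (pi / A))) \<longlonglongrightarrow> sqrt (pi / A) * 1 * (1 / sqrt (pi / A))"
    by (intro tendsto_intros lim1 lim2)
  hence lim3: "(\<lambda>n. 2 * pi * s n * exp (- t n) ^ n / (d n * rgf (exp (- t n))) *
        (rgf (exp (- t n)) / (K * sqrt (t n) * exp (A / t n))) * (1 / sqrt (pi / A))) \<longlonglongrightarrow> 1"
    using A by simp
  have "eventually (\<lambda>n. 2 * pi * s n * exp (- t n) ^ n / (d n * rgf (exp (- t n))) *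
        (rgf (exp (- t n)) / (K * sqrt (t n) * exp (A / t n))) * (1 / sqrt (pi / A))
      = s n / (K * sqrt (A / pi) / (2 * real n) * exp (2 * sqrt (A * real n)))) sequentially"
    using eventually_ge_at_top[of N] eventually_gt_at_top[of 0]
  proof eventually_elim
    case (elim n)
    have t: "0 < t n" "rgf (exp (- t n)) > 0" using N[of n] elim by auto
    \<comment> \<open>Hence \<open>n * t = A / t\<close>, so \<open>exp (n * t)\<close> and
      \<open>exp (A / t)\<close> contribute equally and together give
      \<open>exp (2 * sqrt (A * n))\<close>.\<close>
    have n: "real n = A / (t n)\<^sup>2" using elim A by (simp add: t_def)
    have e1: "exp (- t n) ^ n = exp (- (A / t n))"
    proof -
      have "exp (- t n) ^ n = exp (- (real n * t n))" by (simp flip: exp_of_nat_mult)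
      also have "real n * t n = A / t n" using t unfolding n by (simp add: power2_eq_square)
      finally show ?thesis .
    qed
    have e2: "exp (2 * sqrt (A * real n)) = exp (A / t n) * exp (A / t n)"
    proof -
      have "A * real n = (A / t n)\<^sup>2" unfolding n by (simp add: power2_eq_square)
      hence "sqrt (A * real n) = A / t n" using A t by simp
      thus ?thesis by (simp flip: exp_add)
    qed
    have e3: "d n * sqrt (t n) = (t n)\<^sup>2" using t by (simp add: d_def power2_eq_square)
    have e4: "2 * pi / sqrt (pi / A) / (t n)\<^sup>2 = 2 * real n / sqrt (A / pi)"
    proof -
      have "sqrt (pi / A) = pi / A * sqrt (A / pi)"
        using A by (simp add: real_sqrt_divide field_simps)
      thus ?thesis using A t unfolding n by (simp add: field_simps)
    qed
    have "2 * pi * s n * exp (- t n) ^ n / (d n * rgf (exp (- t n))) *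
        (rgf (exp (- t n)) / (K * sqrt (t n) * exp (A / t n))) * (1 / sqrt (pi / A))
      = s n * (2 * pi / sqrt (pi / A) / (d n * sqrt (t n))) / (K * (exp (A / t n) / exp (- (A / t n))))"
      using t by (simp add: e1 mult_ac)
    also have "\<dots> = s n * (2 * real n / sqrt (A / pi)) / (K * exp (2 * sqrt (A * real n)))"
      unfolding e3 e4 e2 by (simp add: exp_minus field_simps)
    also have "\<dots> = s n / (K * sqrt (A / pi) / (2 * real n) * exp (2 * sqrt (A * real n)))"
      using elim A by (simp add: mult_ac)
    finally show ?case .
  qed
  from Lim_transform_eventually[OF lim3 this] show ?thesis by (rule asymp_equivI')
qed

section \<open>Generating functions of restricted partitions\<close>

definition allowed :: "nat \<Rightarrow> nat \<Rightarrow> nat set" where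
  "allowed m k = (if odd k then if k < 2 * m then {1} else {0, 1} else UNIV)"

text \<open>Only the parts are bounded by \<open>N\<close>, not their sum, so that the generating
  function is a finite product; \<open>N\<close> tends to infinity afterwards.\<close>

definition pod_upto :: "nat \<Rightarrow> nat \<Rightarrow> nat multiset set" where
  "pod_upto m N = {p. set_mset p \<subseteq> {1..N} \<and> (\<forall>k\<in>{1..N}. count p k \<in> allowed m k)}"

definition factor :: "nat \<Rightarrow> nat \<Rightarrow> 'a \<Rightarrow> 'a :: real_normed_field" where
  "factor m k q = (if odd k then if k < 2 * m then q ^ k else 1 + q ^ k else 1 / (1 - q ^ k))"

lemma allowed_has_sum:
  fixes q :: "'a :: {real_normed_field, banach}"
  assumes "norm q < 1" "0 < k"
  shows "((\<lambda>c. q ^ (c * k)) has_sum factor m k q) (allowed m k)"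
proof (cases "odd k")
  case True
  thus ?thesis by (auto simp: allowed_def factor_def intro!: has_sum_finiteI)
next
  case False
  have n: "norm (q ^ k) < 1" using assms by (simp add: norm_power power_less_one_iff)
  have "((\<lambda>c. (q ^ k) ^ c) has_sum (1 / (1 - q ^ k))) UNIV"
    by (rule norm_summable_imp_has_sum) (use n in \<open>auto simp: norm_power intro!: geometric_sums summable_geometric\<close>)
  thus ?thesis using False by (simp add: allowed_def factor_def mult.commute[of _ k] power_mult)
qed

text \<open>All copies of the largest admissible part \<open>Suc N\<close> are split off. This is
  the induction step of the product formula.\<close>

lemma pod_upto_Suc_bij:
  "bij_betw (\<lambda>(p, c). p + replicate_mset c (Suc N)) (pod_upto m N \<times> allowed m (Suc N)) (pod_upto m (Suc N))"
proof (rule bij_betwI[where g = "\<lambda>p. (filter_mset (\<lambda>x. x \<noteq> Suc N) p, count p (Suc N))"])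
  show "(\<lambda>(p, c). p + replicate_mset c (Suc N)) \<in> pod_upto m N \<times> allowed m (Suc N) \<rightarrow> pod_upto m (Suc N)"
  proof clarify
    fix p c assume p: "p \<in> pod_upto m N" and c: "c \<in> allowed m (Suc N)"
    hence "count p (Suc N) = 0" by (force simp: pod_upto_def not_in_iff)
    thus "p + replicate_mset c (Suc N) \<in> pod_upto m (Suc N)"
      using p c by (auto simp: pod_upto_def atLeastAtMostSuc_conv split: if_splits)
  qed
  show "(\<lambda>p. (filter_mset (\<lambda>x. x \<noteq> Suc N) p, count p (Suc N))) \<in> pod_upto m (Suc N) \<rightarrow> pod_upto m N \<times> allowed m (Suc N)"
  proof
    fix p assume p: "p \<in> pod_upto m (Suc N)"
    hence "filter_mset (\<lambda>x. x \<noteq> Suc N) p \<in> pod_upto m N"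
      by (auto simp: pod_upto_def le_Suc_eq)
    moreover have "Suc N \<in> {1..Suc N}" by simp
    hence "count p (Suc N) \<in> allowed m (Suc N)" using p unfolding pod_upto_def by blast
    ultimately show "(filter_mset (\<lambda>x. x \<noteq> Suc N) p, count p (Suc N)) \<in> pod_upto m N \<times> allowed m (Suc N)" by simp
  qed
  fix x assume "x \<in> pod_upto m N \<times> allowed m (Suc N)"
  then obtain p c where x: "x = (p, c)" "p \<in> pod_upto m N" by auto
  have "Suc N \<notin># p" using x by (auto simp: pod_upto_def)
  hence "filter_mset (\<lambda>x. x \<noteq> Suc N) p = p" "count p (Suc N) = 0"
    by (auto simp: filter_mset_eq_conv) (simp add: not_in_iff)
  thus "(filter_mset (\<lambda>x. x \<noteq> Suc N) (case x of (p, c) \<Rightarrow> p + replicate_mset c (Suc N)),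
         count (case x of (p, c) \<Rightarrow> p + replicate_mset c (Suc N)) (Suc N)) = x"
    by (simp add: x(1))
next
  fix p assume "p \<in> pod_upto m (Suc N)"
  show "(case (filter_mset (\<lambda>x. x \<noteq> Suc N) p, count p (Suc N)) of (p, c) \<Rightarrow> p + replicate_mset c (Suc N)) = p"
    by (auto intro!: multiset_eqI)
qed

text \<open>Induction on the largest admissible part. Summability of the norms is part of the claim
  because summing over pairs of a partition and a multiplicity relies on it.\<close>

lemma pod_upto_has_sum:
  fixes q :: "'a :: {real_normed_field, banach}"
  assumes "norm q < 1"
  shows "(\<lambda>p. norm q ^ sum_mset p) summable_on pod_upto m N \<and>
         ((\<lambda>p. q ^ sum_mset p) has_sum (\<Prod>k=1..N. factor m k q)) (pod_upto m N)"
proof (induction N)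
  case 0
  have "pod_upto m 0 = {{#}}" by (auto simp: pod_upto_def)
  thus ?case using has_sum_finite[of "{{#}}" "\<lambda>p. q ^ sum_mset p"] by simp
next
  case (Suc N)
  let ?A = "pod_upto m N" and ?B = "allowed m (Suc N)"
  note bij = pod_upto_Suc_bij[of N m]
  define f where "f = (\<lambda>(p, c). q ^ sum_mset p * q ^ (c * Suc N))"
  define g where "g = (\<lambda>(p, c). norm q ^ sum_mset p * norm q ^ (c * Suc N))"
  have "g summable_on ?A \<times> ?B"
  proof (rule summable_on_SigmaI)
    show "((\<lambda>c. g (p, c)) has_sum (norm q ^ sum_mset p * factor m (Suc N) (norm q))) ?B" for p
      unfolding g_def prod.case by (rule has_sum_cmult_right, rule allowed_has_sum) (use assms in auto)
    show "(\<lambda>p. norm q ^ sum_mset p * factor m (Suc N) (norm q)) summable_on ?A"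
      by (rule summable_on_cmult_left[OF conjunct1[OF Suc]])
    show "g (p, c) \<ge> 0" for p c by (simp add: g_def)
  qed
  moreover have "norm (f x) = g x" for x
    by (simp only: f_def g_def case_prod_unfold norm_mult norm_power)
  ultimately have "f abs_summable_on ?A \<times> ?B" by (simp only:)
  hence f_summable: "f summable_on ?A \<times> ?B" by (rule abs_summable_summable)
  have "(f has_sum ((\<Prod>k=1..N. factor m k q) * factor m (Suc N) q)) (?A \<times> ?B)"
  proof (rule has_sum_SigmaI[OF _ _ f_summable])
    show "((\<lambda>c. f (p, c)) has_sum (q ^ sum_mset p * factor m (Suc N) q)) ?B" for p
      unfolding f_def prod.case by (rule has_sum_cmult_right, rule allowed_has_sum) (use assms in auto)
    show "((\<lambda>p. q ^ sum_mset p * factor m (Suc N) q) has_sum ((\<Prod>k=1..N. factor m k q) * factor m (Suc N) q)) ?A"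
      by (rule has_sum_cmult_left[OF conjunct2[OF Suc]])
  qed
  moreover have "f = (\<lambda>x. q ^ sum_mset ((\<lambda>(p, c). p + replicate_mset c (Suc N)) x))"
    by (simp only: f_def fun_eq_iff split_paired_All prod.case sum_mset.union sum_mset_replicate_mset of_nat_id power_add simp_thms)
  ultimately have "((\<lambda>x. q ^ sum_mset ((\<lambda>(p, c). p + replicate_mset c (Suc N)) x)) has_sum
      ((\<Prod>k=1..N. factor m k q) * factor m (Suc N) q)) (?A \<times> ?B)"
    by (simp only:)
  from iffD1[OF has_sum_reindex_bij_betw[OF bij, of "\<lambda>p. q ^ sum_mset p"] this]
  have "((\<lambda>p. q ^ sum_mset p) has_sum (\<Prod>k=1..Suc N. factor m k q)) (pod_upto m (Suc N))"
    by (simp only: prod.nat_ivl_Suc' mult.commute)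
  moreover have "g = (\<lambda>x. norm q ^ sum_mset ((\<lambda>(p, c). p + replicate_mset c (Suc N)) x))"
    by (simp only: g_def fun_eq_iff split_paired_All prod.case sum_mset.union sum_mset_replicate_mset of_nat_id power_add simp_thms)
  with \<open>g summable_on ?A \<times> ?B\<close>
  have "(\<lambda>x. norm q ^ sum_mset ((\<lambda>(p, c). p + replicate_mset c (Suc N)) x)) summable_on ?A \<times> ?B"
    by (simp only:)
  from iffD1[OF summable_on_reindex_bij_betw[OF bij, of "\<lambda>p. norm q ^ sum_mset p"] this]
  have "(\<lambda>p. norm q ^ sum_mset p) summable_on pod_upto m (Suc N)" .
  ultimately show ?case by blast
qed

lemma pod_upto_subset: "{p \<in> pod_upto m N. sum_mset p = n} \<subseteq> partitions_of n"
proof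
  fix p assume p: "p \<in> {p \<in> pod_upto m N. sum_mset p = n}"
  hence "set_mset p \<subseteq> {1..N}" by (simp add: pod_upto_def)
  hence "\<forall>k\<in>#p. 0 < k" by force
  thus "p \<in> partitions_of n" using p by (simp add: partitions_of_def)
qed

lemma pod_upto_sums:
  fixes q :: "'a :: {real_normed_field, banach}"
  assumes "norm q < 1"
  shows "(\<lambda>n. of_nat (card {p \<in> pod_upto m N. sum_mset p = n}) * q ^ n) sums (\<Prod>k=1..N. factor m k q)"
proof -
  let ?P = "\<lambda>n. {p \<in> pod_upto m N. sum_mset p = n}"
  have "bij_betw snd (Sigma UNIV ?P) (pod_upto m N)"
    by (rule bij_betwI[where g = "\<lambda>p. (sum_mset p, p)"]) (auto simp: Pi_iff)
  from iffD2[OF has_sum_reindex_bij_betw[OF this, of "\<lambda>p. q ^ sum_mset p"] conjunct2[OF pod_upto_has_sum[OF assms, of m N]]]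
  have "((\<lambda>x. q ^ sum_mset (snd x)) has_sum (\<Prod>k=1..N. factor m k q)) (Sigma UNIV ?P)" .
  hence "((\<lambda>n. of_nat (card (?P n)) * q ^ n) has_sum (\<Prod>k=1..N. factor m k q)) UNIV"
  proof (rule has_sum_SigmaD)
    fix n
    have "(\<Sum>p\<in>?P n. q ^ sum_mset (snd (n, p))) = (\<Sum>p\<in>?P n. q ^ n)" by (rule sum.cong) simp_all
    hence eq: "of_nat (card (?P n)) * q ^ n = (\<Sum>p\<in>?P n. q ^ sum_mset (snd (n, p)))" by simp
    show "((\<lambda>p. q ^ sum_mset (snd (n, p))) has_sum (of_nat (card (?P n)) * q ^ n)) (?P n)"
      unfolding eq by (rule has_sum_finite[OF finite_subset[OF pod_upto_subset finite_partitions_of]])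
  qed
  thus ?thesis by (rule has_sum_imp_sums)
qed

section \<open>Removing the bound on the parts\<close>

definition pod_count :: "nat \<Rightarrow> nat \<Rightarrow> nat" where
  "pod_count m n = card {p \<in> P_od n. \<forall>k. odd k \<and> k < 2 * m \<longrightarrow> k \<in># p}"

text \<open>With \<open>2 * m \<le> N\<close> all forced odd parts lie below the bound. The
  inclusion holds for every \<open>n\<close>, which provides the majorant when \<open>N\<close>
  grows.\<close>

lemma pod_upto_subset_P_od:
  assumes "2 * m \<le> N"
  shows "{p \<in> pod_upto m N. sum_mset p = n} \<subseteq> {p \<in> P_od n. \<forall>k. odd k \<and> k < 2 * m \<longrightarrow> k \<in># p}"
proof safe
  fix p assume p: "p \<in> pod_upto m N"
  have "count p k \<le> 1" if "odd k" for k
  proof (cases "k \<in> {1..N}")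
    case True
    hence "count p k \<in> allowed m k" using p by (auto simp: pod_upto_def)
    thus ?thesis using that by (auto simp: allowed_def split: if_splits)
  next
    case False
    hence "k \<notin># p" using p by (auto simp: pod_upto_def)
    thus ?thesis by (simp add: not_in_iff)
  qed
  thus "p \<in> P_od (sum_mset p)"
    using p by (auto simp: P_od_def partitions_of_def pod_upto_def)
next
  fix p k assume p: "p \<in> pod_upto m N" and k: "odd k" "k < 2 * m"
  have "k \<in> {1..N}" using k assms by (auto simp: Suc_le_eq intro: odd_pos)
  hence "count p k \<in> allowed m k" using p by (auto simp: pod_upto_def)
  hence "count p k = 1" using k by (simp add: allowed_def)
  thus "k \<in># p" by (metis count_greater_zero_iff zero_less_one)
qed

text \<open>No part exceeds the sum \<open>n\<close>, so for \<open>n \<le> N\<close> the bound on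
  the parts excludes nothing.\<close>

lemma pod_upto_eq_P_od:
  assumes "2 * m \<le> N" "n \<le> N"
  shows "{p \<in> pod_upto m N. sum_mset p = n} = {p \<in> P_od n. \<forall>k. odd k \<and> k < 2 * m \<longrightarrow> k \<in># p}"
proof (rule antisym[OF pod_upto_subset_P_od[OF assms(1)]], safe)
  fix p assume p: "p \<in> P_od n" and c: "\<forall>k. odd k \<and> k < 2 * m \<longrightarrow> k \<in># p"
  show "sum_mset p = n" using p by (simp add: P_od_def partitions_of_def)
  have "set_mset p \<subseteq> {1..N}"
  proof
    fix k assume "k \<in># p"
    hence "k \<le> sum_mset p" by (metis le_add1 multi_member_split sum_mset.add_mset)
    thus "k \<in> {1..N}" using p assms \<open>k \<in># p\<close> by (auto simp: P_od_def partitions_of_def Suc_le_eq)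
  qed
  moreover have "count p k \<in> allowed m k" for k
  proof -
    have 1: "count p k \<le> 1" if "odd k" using p that by (simp add: P_od_def)
    have "count p k = 1" if "odd k" "k < 2 * m"
      using 1 c that not_in_iff[of k p] by (metis le_less less_one)
    moreover have "count p k = 0 \<or> count p k = 1" if "odd k" using 1[OF that] by linarith
    ultimately show ?thesis by (auto simp: allowed_def)
  qed
  ultimately show "p \<in> pod_upto m N" by (simp add: pod_upto_def)
qed

lemma card_pod_upto_le: "2 * m \<le> N \<Longrightarrow> card {p \<in> pod_upto m N. sum_mset p = n} \<le> pod_count m n"
  unfolding pod_count_def by (rule card_mono[OF _ pod_upto_subset_P_od]) (simp_all add: finite_P_od)

lemma card_pod_upto_eq: "2 * m \<le> N \<Longrightarrow> n \<le> N \<Longrightarrow> card {p \<in> pod_upto m N. sum_mset p = n} = pod_count m n"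
  unfolding pod_count_def by (simp add: pod_upto_eq_P_od)

lemma factor_real_bounds:
  fixes r :: real
  assumes "0 \<le> r" "r < 1" "0 < k"
  shows "0 \<le> factor m k r" "factor m k r \<le> 1 / (1 - r ^ k)"
proof -
  define x where "x = r ^ k"
  have x: "0 \<le> x" "x < 1" using assms by (auto simp: x_def power_less_one_iff)
  have "(1 + x) * (1 - x) \<le> 1" by (simp add: algebra_simps)
  hence 1: "1 + x \<le> 1 / (1 - x)" using x by (simp add: le_divide_eq)
  show "0 \<le> factor m k r" "factor m k r \<le> 1 / (1 - r ^ k)"
    using x 1 unfolding factor_def x_def[symmetric] by auto
qed

text \<open>Every factor is at most \<open>exp (r ^ k / (1 - r))\<close>, and the exponents form a
  geometric series. Uniformity in \<open>N\<close> is what gives convergence inside the unit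
  disc.\<close>

lemma prod_factor_bounded:
  fixes r :: real
  assumes "0 \<le> r" "r < 1"
  shows "(\<Prod>k=1..N. factor m k r) \<le> exp (1 / (1 - r)\<^sup>2)"
proof -
  have "(\<Prod>k=1..N. factor m k r) \<le> (\<Prod>k=1..N. exp (r ^ k / (1 - r)))"
  proof (rule prod_mono)
    fix k assume "k \<in> {1..N}"
    hence k: "k > 0" by simp
    have le: "r ^ k \<le> r" using assms power_decreasing[of 1 k r] k by simp
    have "1 / (1 - r ^ k) = 1 + r ^ k / (1 - r ^ k)" using assms le by (simp add: field_simps)
    also have "\<dots> \<le> 1 + r ^ k / (1 - r)"
      using assms le by (intro add_left_mono divide_left_mono mult_pos_pos) auto
    also have "\<dots> \<le> exp (r ^ k / (1 - r))" by (rule exp_ge_add_one_self)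
    finally show "0 \<le> factor m k r \<and> factor m k r \<le> exp (r ^ k / (1 - r))"
      using factor_real_bounds[OF assms k, of m] by linarith
  qed
  also have "\<dots> = exp ((\<Sum>k=1..N. r ^ k) / (1 - r))" by (simp add: exp_sum sum_divide_distrib)
  also have "(\<Sum>k=1..N. r ^ k) \<le> (\<Sum>k. r ^ k)"
    using assms by (intro sum_le_suminf summable_geometric) auto
  also have "\<dots> = 1 / (1 - r)" using assms by (intro suminf_geometric) auto
  finally show ?thesis using assms by (simp add: power2_eq_square divide_right_mono)
qed

lemma summable_pod_count:
  fixes r :: real
  assumes r: "0 \<le> r" "r < 1"
  shows "summable (\<lambda>n. real (pod_count m n) * r ^ n)"
proof (rule summableI_nonneg_bounded)
    fix M
    \<comment> \<open>At this bound the first \<open>M\<close> coefficients already have their final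
      values.\<close>
    let ?N = "M + 2 * m"
    have s: "(\<lambda>n. real (card {p \<in> pod_upto m ?N. sum_mset p = n}) * r ^ n) sums (\<Prod>k=1..?N. factor m k r)"
      using pod_upto_sums[of r m ?N] r by simp
    have "(\<Sum>n<M. real (pod_count m n) * r ^ n) = (\<Sum>n<M. real (card {p \<in> pod_upto m ?N. sum_mset p = n}) * r ^ n)"
      by (intro sum.cong) (auto simp: card_pod_upto_eq)
    also have "\<dots> \<le> (\<Sum>n. real (card {p \<in> pod_upto m ?N. sum_mset p = n}) * r ^ n)"
      using s r by (intro sum_le_suminf) (auto simp: sums_iff)
    also have "\<dots> = (\<Prod>k=1..?N. factor m k r)" using s by (simp add: sums_iff)
    also have "\<dots> \<le> exp (1 / (1 - r)\<^sup>2)" by (rule prod_factor_bounded[OF r])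
    finally show "(\<Sum>n<M. real (pod_count m n) * r ^ n) \<le> exp (1 / (1 - r)\<^sup>2)" .
  show "0 \<le> real (pod_count m n) * r ^ n" for n using r by simp
qed

interpretation pod: nonneg_power_series "\<lambda>n. real (pod_count m n)" for m
proof (rule nonneg_power_series.intro)
  show "0 \<le> real (pod_count m n)" for m n by simp
  show "summable (\<lambda>n. real (pod_count m n) * r ^ n)" if "0 \<le> r" "r < 1" for m r
    using that by (rule summable_pod_count)
qed

abbreviation podC :: "nat \<Rightarrow> complex \<Rightarrow> complex" where "podC m \<equiv> pod.cgf m"
abbreviation podR :: "nat \<Rightarrow> real \<Rightarrow> real" where "podR m \<equiv> pod.rgf m"

text \<open>Tannery's theorem: each coefficient is eventually constant in \<open>N\<close> and never
  exceeds its final value once \<open>2 * m \<le> N\<close>. The general field serves the real and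
  the complex series at once.\<close>

lemma tendsto_prod_factor:
  fixes q :: "'a :: {real_normed_field, banach}"
  assumes "norm q < 1"
  shows "(\<lambda>N. \<Prod>k=1..N. factor m k q) \<longlonglongrightarrow> (\<Sum>n. of_nat (pod_count m n) * q ^ n)"
proof -
  define a where "a = (\<lambda>n N. of_nat (card {p \<in> pod_upto m N. sum_mset p = n}) * q ^ n)"
  have lim: "(\<lambda>N. a n N) \<longlonglongrightarrow> of_nat (pod_count m n) * q ^ n" for n
  proof (rule tendsto_eventually)
    show "eventually (\<lambda>N. a n N = of_nat (pod_count m n) * q ^ n) sequentially"
      using eventually_ge_at_top[of "max (2 * m) n"] by eventually_elim (simp add: a_def card_pod_upto_eq)
  qed
  have bnd: "norm (a n N) \<le> real (pod_count m n) * norm q ^ n" if "2 * m \<le> N" for n N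
    unfolding a_def using card_pod_upto_le[OF that, of n] by (simp add: norm_mult norm_power mult_right_mono)
  have ev: "eventually (\<lambda>(n, N). norm (a n N) \<le> real (pod_count m n) * norm q ^ n) (at_top \<times>\<^sub>F at_top)"
    by (rule eventually_mono[OF eventually_prodI[OF always_eventually[of "\<lambda>_. True"] eventually_ge_at_top[of "2 * m"]]])
       (use bnd in auto)
  have "(\<lambda>N. suminf (\<lambda>n. a n N)) \<longlonglongrightarrow> (\<Sum>n. of_nat (pod_count m n) * q ^ n)"
    using tannerys_theorem[of a "\<lambda>n. of_nat (pod_count m n) * q ^ n" sequentially "\<lambda>n. real (pod_count m n) * norm q ^ n", OF lim ev]
      pod.summable_power[of "norm q" m] assms by simp
  moreover have "suminf (\<lambda>n. a n N) = (\<Prod>k=1..N. factor m k q)" for N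
    using pod_upto_sums[OF assms, of m N] by (simp add: a_def sums_iff)
  ultimately show ?thesis by simp
qed

lemma tendsto_prod_factor_complex: "norm q < 1 \<Longrightarrow> (\<lambda>N. \<Prod>k=1..N. factor m k q) \<longlonglongrightarrow> podC m q"
  using tendsto_prod_factor[of q m] by (simp add: pod.cgf_def)

lemma tendsto_prod_factor_real: "0 \<le> r \<Longrightarrow> r < 1 \<Longrightarrow> (\<lambda>N. \<Prod>k=1..N. factor m k r) \<longlonglongrightarrow> podR m r"
  using tendsto_prod_factor[of r m] by (simp add: pod.rgf_def)

text \<open>Passing from \<open>m\<close> to \<open>Suc m\<close> changes only the factor at
  \<open>2 * m + 1\<close>, from \<open>1 + r ^ k\<close> to \<open>r ^ k\<close>.\<close>

lemma podR_Suc: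
  assumes "0 \<le> r" "r < 1"
  shows "podR (Suc m) r = podR m r * (r ^ (2 * m + 1) / (1 + r ^ (2 * m + 1)))"
proof (rule LIMSEQ_unique[OF tendsto_prod_factor_real[OF assms]])
  let ?k = "2 * m + 1"
  have pos: "1 + r ^ ?k > 0" using assms by (intro add_pos_nonneg) auto
  have "(\<Prod>k=1..N. factor m k r) * (r ^ ?k / (1 + r ^ ?k)) = (\<Prod>k=1..N. factor (Suc m) k r)" if "?k \<le> N" for N
  proof -
    have k: "?k \<in> {1..N}" using that by auto
    have "(\<Prod>k\<in>{1..N} - {?k}. factor m k r) = (\<Prod>k\<in>{1..N} - {?k}. factor (Suc m) k r)"
    proof (rule prod.cong[OF refl])
      fix k assume "k \<in> {1..N} - {?k}"
      hence "k \<noteq> 2 * m + 1" by simp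
      thus "factor m k r = factor (Suc m) k r"
        by (cases "odd k"; cases "k < 2 * m"; cases "k < 2 * Suc m") (auto simp: factor_def elim!: oddE)
    qed
    moreover have "factor m ?k r = 1 + r ^ ?k" "factor (Suc m) ?k r = r ^ ?k"
      by (simp_all add: factor_def)
    ultimately show ?thesis
      using pos unfolding prod.remove[OF finite_atLeastAtMost k] by simp
  qed
  hence "eventually (\<lambda>N. (\<Prod>k=1..N. factor m k r) * (r ^ ?k / (1 + r ^ ?k)) = (\<Prod>k=1..N. factor (Suc m) k r)) sequentially"
    by (rule eventually_mono[OF eventually_ge_at_top[of ?k]])
  moreover have "(\<lambda>N. (\<Prod>k=1..N. factor m k r) * (r ^ ?k / (1 + r ^ ?k))) \<longlonglongrightarrow> podR m r * (r ^ ?k / (1 + r ^ ?k))"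
    by (intro tendsto_mult tendsto_prod_factor_real assms tendsto_const)
  ultimately show "(\<lambda>N. \<Prod>k=1..N. factor (Suc m) k r) \<longlonglongrightarrow> podR m r * (r ^ ?k / (1 + r ^ ?k))"
    by (rule Lim_transform_eventually[rotated])
qed

section \<open>The quotients \<open>F\<^sub>m / F\<^sub>0\<close>\<close>

definition odd_ratio :: "nat \<Rightarrow> real \<Rightarrow> real" where
  "odd_ratio m r = (\<Prod>j<m. r ^ (2 * j + 1) / (1 + r ^ (2 * j + 1)))"

lemma podR_eq_odd_ratio:
  assumes "0 \<le> r" "r < 1"
  shows "podR m r = podR 0 r * odd_ratio m r"
proof (induction m)
  case (Suc m)
  show ?case unfolding podR_Suc[OF assms] Suc.IH by (simp add: odd_ratio_def)
qed (simp add: odd_ratio_def)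

lemma odd_ratio_bounds:
  assumes "0 \<le> r" "r < 1"
  shows "0 \<le> odd_ratio m r" "odd_ratio m r \<le> (1 / 2) ^ m"
proof -
  have 1: "0 \<le> r ^ j / (1 + r ^ j) \<and> r ^ j / (1 + r ^ j) \<le> 1 / 2" for j
  proof -
    have "0 \<le> r ^ j" "r ^ j \<le> 1" using assms by (auto intro: power_le_one)
    thus ?thesis by (simp add: field_simps)
  qed
  show "0 \<le> odd_ratio m r" unfolding odd_ratio_def by (intro prod_nonneg ballI conjunct1[OF 1])
  have "odd_ratio m r \<le> (\<Prod>j<m. 1 / 2)" unfolding odd_ratio_def by (rule prod_mono) (rule 1)
  thus "odd_ratio m r \<le> (1 / 2) ^ m" by simp
qed

section \<open>Bounds off the real axis\<close>

text \<open>With \<open>y = norm z - Re z\<close> one has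
  \<open>(norm (1 + z))\<^sup>2 = (1 + norm z)\<^sup>2 - 2 * y\<close>. Since
  \<open>(1 + norm z)\<^sup>2 \<le> 4\<close>, the loss is at least a relative factor
  \<open>1 - y / 2\<close>.\<close>

lemma norm_one_plus_le:
  fixes z :: complex
  assumes "norm z < 1"
  shows "norm (1 + z) \<le> (1 + norm z) * exp (- ((norm z - Re z) / 4))"
proof (rule power2_le_imp_le)
  define \<rho> y where "\<rho> = norm z" and "y = norm z - Re z"
  have y: "0 \<le> y" using complex_Re_le_cmod[of z] by (simp add: y_def)
  have \<rho>: "0 \<le> \<rho>" "\<rho> < 1" using assms by (auto simp: \<rho>_def)
  have "(norm (1 + z))\<^sup>2 = (1 + \<rho>)\<^sup>2 - 2 * y"
  proof -
    have "(norm (1 + z))\<^sup>2 = 1 + 2 * Re z + (norm z)\<^sup>2"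
      unfolding cmod_power2 by (simp add: power2_eq_square algebra_simps)
    thus ?thesis by (simp add: \<rho>_def y_def power2_sum)
  qed
  also have "\<dots> \<le> (1 + \<rho>)\<^sup>2 * (1 - y / 2)"
  proof -
    have "(1 + \<rho>)\<^sup>2 \<le> 2\<^sup>2" using \<rho> by (intro power_mono) auto
    hence "(1 + \<rho>)\<^sup>2 * (y / 2) \<le> 4 * (y / 2)" using y by (intro mult_right_mono) auto
    thus ?thesis by (simp add: right_diff_distrib)
  qed
  also have "\<dots> \<le> (1 + \<rho>)\<^sup>2 * exp (- (y / 2))"
    using exp_ge_add_one_self[of "- (y / 2)"] by (intro mult_left_mono) auto
  also have "exp (- (y / 2)) = (exp (- (y / 4)))\<^sup>2" by (simp flip: exp_double)
  finally show "(norm (1 + z))\<^sup>2 \<le> ((1 + norm z) * exp (- ((norm z - Re z) / 4)))\<^sup>2"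
    by (simp add: power_mult_distrib \<rho>_def y_def)
qed auto

text \<open>Here \<open>(norm (1 - z))\<^sup>2 = (1 - norm z)\<^sup>2 + 2 * y\<close>, and
  \<open>exp (y / 2) \<le> 1 + 2 * y\<close> on \<open>[0, 2]\<close>. The constant
  \<open>1 / 4\<close> agrees with the one for \<open>1 + z\<close>, so the gains of all factors add
  up uniformly.\<close>

lemma norm_inverse_one_minus_le:
  fixes z :: complex
  assumes "norm z < 1"
  shows "norm (1 / (1 - z)) \<le> 1 / (1 - norm z) * exp (- ((norm z - Re z) / 4))"
proof -
  define \<rho> y where "\<rho> = norm z" and "y = norm z - Re z"
  have \<rho>: "0 \<le> \<rho>" "\<rho> < 1" using assms by (auto simp: \<rho>_def)
  have y: "0 \<le> y" "y \<le> 2"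
    using complex_Re_le_cmod[of z] abs_Re_le_cmod[of z] assms unfolding y_def by linarith+
  have "(1 - \<rho>) * exp (y / 4) \<le> norm (1 - z)"
  proof (rule power2_le_imp_le)
    have "exp (y / 2) \<le> 1 + y / 2 + (y / 2)\<^sup>2" using y by (intro exp_bound) auto
    also have "(y / 2)\<^sup>2 \<le> y / 2" using y mult_left_le[of "y / 2" "y / 2"] by (simp add: power2_eq_square)
    finally have e: "exp (y / 2) \<le> 1 + 2 * y" using y by linarith
    have "((1 - \<rho>) * exp (y / 4))\<^sup>2 = (1 - \<rho>)\<^sup>2 * exp (y / 2)"
      by (simp add: power_mult_distrib flip: exp_double)
    also have "\<dots> \<le> (1 - \<rho>)\<^sup>2 * (1 + 2 * y)" by (intro mult_left_mono e) auto
    also have "\<dots> \<le> (1 - \<rho>)\<^sup>2 + 2 * y"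
    proof -
      have "(1 - \<rho>)\<^sup>2 \<le> 1" using \<rho> by (intro power_le_one) auto
      hence "(1 - \<rho>)\<^sup>2 * (2 * y) \<le> 1 * (2 * y)" using y by (intro mult_right_mono) auto
      thus ?thesis by (simp add: distrib_left)
    qed
    also have "\<dots> = (norm (1 - z))\<^sup>2"
    proof -
      have "(norm (1 - z))\<^sup>2 = 1 - 2 * Re z + (norm z)\<^sup>2"
        unfolding cmod_power2 by (simp add: power2_eq_square algebra_simps)
      thus ?thesis by (simp add: \<rho>_def y_def power2_diff)
    qed
    finally show "((1 - \<rho>) * exp (y / 4))\<^sup>2 \<le> (norm (1 - z))\<^sup>2" .
  qed simp
  moreover have "0 < (1 - \<rho>) * exp (y / 4)" using \<rho> by simp
  ultimately have "1 / norm (1 - z) \<le> 1 / ((1 - \<rho>) * exp (y / 4))" 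
    by (intro frac_le) auto
  also have "\<dots> = 1 / (1 - \<rho>) * exp (- (y / 4))" by (simp add: exp_minus field_simps)
  finally show ?thesis by (simp add: norm_divide \<rho>_def y_def)
qed

text \<open>The forced factors \<open>q ^ k\<close> gain nothing, and the gain of even
  \<open>k \<le> 2 * m\<close> is discarded, so that the remaining gains run over consecutive
  \<open>k\<close>.\<close>

lemma norm_factor_le:
  fixes q :: complex
  assumes "norm q < 1" "0 < k"
  shows "norm (factor m k q) \<le> factor m k (norm q) * (if 2 * m < k then exp (- ((norm q ^ k - Re (q ^ k)) / 4)) else 1)"
proof -
  have n: "norm (q ^ k) < 1" using assms by (simp add: norm_power power_less_one_iff)
  have e: "exp (- ((norm q ^ k - Re (q ^ k)) / 4)) \<le> 1"
    using complex_Re_le_cmod[of "q ^ k"] by (simp add: norm_power)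
  have 1: "norm (1 / (1 - q ^ k)) \<le> 1 / (1 - norm q ^ k) * exp (- ((norm q ^ k - Re (q ^ k)) / 4))"
    using norm_inverse_one_minus_le[OF n] by (simp add: norm_power)
  have "1 / (1 - norm q ^ k) * exp (- ((norm q ^ k - Re (q ^ k)) / 4)) \<le> 1 / (1 - norm q ^ k) * 1"
    using n e by (intro mult_left_mono) (auto simp: norm_power)
  hence 2: "norm (1 / (1 - q ^ k)) \<le> 1 / (1 - norm q ^ k)" using 1 by linarith
  have 3: "norm (1 + q ^ k) \<le> (1 + norm q ^ k) * exp (- ((norm q ^ k - Re (q ^ k)) / 4))"
    using norm_one_plus_le[OF n] by (simp add: norm_power)
  have neq: "k \<noteq> 2 * m" if "odd k" using that by auto
  show ?thesis
  proof (cases "odd k")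
    case True
    thus ?thesis using 3 neq[OF True] by (cases "k < 2 * m") (simp_all add: factor_def norm_power)
  next
    case False
    thus ?thesis using 1 2 by (simp add: factor_def)
  qed
qed

text \<open>The gains \<open>r ^ k - Re (q ^ k)\<close> for \<open>k > 2 * m\<close> sum to two
  geometric series; the real part of the second is then bounded by its modulus.\<close>

lemma norm_podC_le:
  fixes q :: complex
  assumes "norm q < 1"
  shows "norm (podC m q) \<le> podR m (norm q) *
           exp (- (norm q ^ (2 * m + 1) * (1 / (1 - norm q) - 1 / norm (1 - q)) / 4))"
proof -
  define r where "r = norm q"
  have r: "0 \<le> r" "r < 1" using assms by (auto simp: r_def)
  define a where "a = (\<lambda>k. r ^ k - Re (q ^ k))"
  define l where "l = r ^ (2 * m + 1) / (1 - r) - Re (q ^ (2 * m + 1) / (1 - q))"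
  have prodle: "norm (\<Prod>k=1..2 * m + N. factor m k q) \<le> (\<Prod>k=1..2 * m + N. factor m k r) * exp (- ((\<Sum>j<N. a (2 * m + 1 + j)) / 4))" for N
  proof -
    let ?e = "\<lambda>k. if 2 * m < k then exp (- (a k / 4)) else 1"
    have "norm (\<Prod>k=1..2 * m + N. factor m k q) \<le> (\<Prod>k=1..2 * m + N. factor m k r * ?e k)"
      unfolding prod_norm[symmetric] a_def r_def using assms by (intro prod_mono conjI norm_factor_le) auto
    also have "\<dots> = (\<Prod>k=1..2 * m + N. factor m k r) * (\<Prod>k=1..2 * m + N. ?e k)"
      by (rule prod.distrib)
    also have "(\<Prod>k=1..2 * m + N. ?e k) = (\<Prod>k\<in>{2 * m + 1..2 * m + N}. exp (- (a k / 4)))"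
      by (rule prod.mono_neutral_cong_right) auto
    also have "\<dots> = (\<Prod>j<N. exp (- (a (2 * m + 1 + j) / 4)))"
      by (rule prod.reindex_bij_witness[of _ "\<lambda>j. 2 * m + 1 + j" "\<lambda>k. k - (2 * m + 1)"]) auto
    also have "\<dots> = exp (- ((\<Sum>j<N. a (2 * m + 1 + j)) / 4))"
      by (simp add: exp_sum sum_negf[symmetric] sum_divide_distrib)
    finally show ?thesis .
  qed
  have "(\<lambda>j. r ^ (2 * m + 1) * r ^ j) sums (r ^ (2 * m + 1) * (1 / (1 - r)))"
    using r by (intro sums_mult geometric_sums) auto
  moreover have "(\<lambda>j. Re (q ^ (2 * m + 1) * q ^ j)) sums Re (q ^ (2 * m + 1) * (1 / (1 - q)))"
    using assms by (intro sums_Re sums_mult geometric_sums) auto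
  ultimately have "(\<lambda>j. r ^ (2 * m + 1) * r ^ j - Re (q ^ (2 * m + 1) * q ^ j)) sums
      (r ^ (2 * m + 1) * (1 / (1 - r)) - Re (q ^ (2 * m + 1) * (1 / (1 - q))))" by (rule sums_diff)
  hence "(\<lambda>j. a (2 * m + 1 + j)) sums l"
    unfolding a_def l_def by (simp only: power_add times_divide_eq_right mult_1_right)
  hence suml: "(\<lambda>N. \<Sum>j<N. a (2 * m + 1 + j)) \<longlonglongrightarrow> l" by (simp add: sums_def)
  have off: "filterlim (\<lambda>N. 2 * m + N) sequentially sequentially"
    by (rule filterlim_add_const_nat_at_top[of "2 * m", unfolded add.commute[of _ "2 * m"]])
  have lim1: "(\<lambda>N. norm (\<Prod>k=1..2 * m + N. factor m k q)) \<longlonglongrightarrow> norm (podC m q)"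
    by (intro tendsto_norm filterlim_compose[OF tendsto_prod_factor_complex[OF assms] off])
  have lim2: "(\<lambda>N. (\<Prod>k=1..2 * m + N. factor m k r) * exp (- ((\<Sum>j<N. a (2 * m + 1 + j)) / 4))) \<longlonglongrightarrow> podR m r * exp (- (l / 4))"
    by (intro tendsto_mult filterlim_compose[OF tendsto_prod_factor_real[OF r] off] tendsto_exp tendsto_minus tendsto_divide suml tendsto_const) auto
  have "norm (podC m q) \<le> podR m r * exp (- (l / 4))"
    by (rule LIMSEQ_le[OF lim1 lim2]) (use prodle in auto)
  also have "\<dots> \<le> podR m r * exp (- (r ^ (2 * m + 1) * (1 / (1 - r) - 1 / norm (1 - q)) / 4))"
  proof -
    have "Re (q ^ (2 * m + 1) / (1 - q)) \<le> norm (q ^ (2 * m + 1) / (1 - q))" by (rule complex_Re_le_cmod)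
    also have "\<dots> = r ^ (2 * m + 1) * (1 / norm (1 - q))" by (simp add: norm_divide norm_power norm_mult r_def)
    finally have "r ^ (2 * m + 1) * (1 / (1 - r) - 1 / norm (1 - q)) \<le> l"
      unfolding l_def right_diff_distrib by simp
    thus ?thesis using pod.rgf_nonneg[OF r, of m] by (intro mult_left_mono) auto
  qed
  finally show ?thesis by (simp only: r_def)
qed

section \<open>The moex sums\<close>

text \<open>If \<open>moex p = 2 * j + 1\<close>, the condition on \<open>m\<close> holds exactly
  for \<open>m \<le> j\<close>, giving \<open>1 + 2 * j\<close>. The cutoff at \<open>n\<close> is
  harmless: for \<open>j > 0\<close> the part \<open>2 * j - 1\<close> occurs, hence
  \<open>j \<le> n\<close>.\<close>

lemma moex_eq_sum:
  assumes "p \<in> P_od n"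
  shows "moex p = (\<Sum>m\<le>n. (if m = 0 then 1 else 2) * of_bool (\<forall>k. odd k \<and> k < 2 * m \<longrightarrow> k \<in># p))"
proof -
  have "\<exists>k. odd k \<and> k \<notin># p"
  proof -
    obtain b where b: "\<forall>k\<in>set_mset p. k \<le> b" using finite_nat_set_iff_bounded_le[of "set_mset p"] by auto
    have "2 * b + 1 \<notin># p" using b by force
    thus ?thesis by (intro exI[of _ "2 * b + 1"]) auto
  qed
  hence odd: "odd (moex p)" and notin: "moex p \<notin># p"
    using LeastI_ex[of "\<lambda>k. odd k \<and> k \<notin># p"] by (auto simp: moex_def)
  have least: "k \<in># p" if "odd k" "k < moex p" for k
    using not_less_Least[of k "\<lambda>k. odd k \<and> k \<notin># p"] that by (auto simp: moex_def)
  obtain j where j: "moex p = 2 * j + 1" using odd by (elim oddE)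
  have iff: "(\<forall>k. odd k \<and> k < 2 * m \<longrightarrow> k \<in># p) \<longleftrightarrow> m \<le> j" for m
  proof
    assume "\<forall>k. odd k \<and> k < 2 * m \<longrightarrow> k \<in># p"
    hence "\<not> moex p < 2 * m" using odd notin by blast
    thus "m \<le> j" using j by linarith
  next
    assume "m \<le> j"
    thus "\<forall>k. odd k \<and> k < 2 * m \<longrightarrow> k \<in># p" using j by (auto intro!: least)
  qed
  have "j \<le> n"
  proof (cases j)
    case (Suc i)
    have "2 * i + 1 \<in># p" using j Suc by (intro least) auto
    hence "2 * i + 1 \<le> sum_mset p" by (metis le_add1 multi_member_split sum_mset.add_mset)
    thus ?thesis using assms Suc by (auto simp: P_od_def partitions_of_def)
  qed simp
  have "(\<Sum>m\<le>n. (if m = 0 then 1 else 2) * of_bool (m \<le> j)) = (\<Sum>m\<le>j. if m = 0 then 1 else 2 :: nat)"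
    using \<open>j \<le> n\<close> by (intro sum.mono_neutral_cong_right) auto
  also have "\<dots> = 2 * j + 1" by (induction j) auto
  finally show ?thesis unfolding iff j by simp
qed

definition moex_weight :: "nat \<Rightarrow> real" where
  "moex_weight m = (if m = 0 then 1 else 2)"

lemma sigma_od_moex_eq_sum: "real (sigma_od_moex n) = (\<Sum>m\<le>n. moex_weight m * real (pod_count m n))"
proof -
  have "sigma_od_moex n = (\<Sum>p\<in>P_od n. \<Sum>m\<le>n. (if m = 0 then 1 else 2) * of_bool (\<forall>k. odd k \<and> k < 2 * m \<longrightarrow> k \<in># p))"
    unfolding sigma_od_moex_def by (intro sum.cong refl moex_eq_sum)
  also have "\<dots> = (\<Sum>m\<le>n. \<Sum>p\<in>P_od n. (if m = 0 then 1 else 2) * of_bool (\<forall>k. odd k \<and> k < 2 * m \<longrightarrow> k \<in># p))"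
    by (rule sum.swap)
  also have "\<dots> = (\<Sum>m\<le>n. (if m = 0 then 1 else 2) * pod_count m n)"
  proof (rule sum.cong[OF refl])
    fix m
    have "(\<Sum>p\<in>P_od n. of_bool (Q p)) = card {p \<in> P_od n. Q p}" for Q
      by (simp add: finite_P_od Int_def)
    thus "(\<Sum>p\<in>P_od n. (if m = 0 then 1 else 2) * of_bool (\<forall>k. odd k \<and> k < 2 * m \<longrightarrow> k \<in># p))
        = (if m = 0 then 1 else 2) * pod_count m n"
      by (simp only: pod_count_def sum_distrib_left[symmetric])
  qed
  finally show ?thesis by (simp add: moex_weight_def if_distrib[of real] cong: if_cong)
qed

text \<open>The required part \<open>2 * m - 1\<close> would exceed \<open>n\<close>. Thus sums over
  \<open>m \<le> n\<close> may be extended to all \<open>m\<close> when the order of summation is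
  changed.\<close>

lemma pod_count_eq_0:
  assumes "n < m"
  shows "pod_count m n = 0"
proof -
  have False if p: "p \<in> P_od n" "\<forall>k. odd k \<and> k < 2 * m \<longrightarrow> k \<in># p" for p
  proof -
    obtain i where i: "m = Suc i" using assms by (cases m) auto
    have "2 * i + 1 \<in># p" using p(2) i by simp
    hence "2 * i + 1 \<le> sum_mset p" by (metis le_add1 multi_member_split sum_mset.add_mset)
    thus False using p(1) assms i by (auto simp: P_od_def partitions_of_def)
  qed
  thus ?thesis unfolding pod_count_def by (simp add: card_eq_0_iff) blast
qed

section \<open>The generating function of the moex sums\<close>

lemma moex_weight_nonneg: "0 \<le> moex_weight m" and moex_weight_le: "moex_weight m \<le> 2"
  by (auto simp: moex_weight_def)

text \<open>Both series are iterated sums of one double series, absolutely summable because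
  \<open>podR m r \<le> podR 0 r / 2 ^ m\<close>. The common value is left abstract: naming it
  \<open>sigma.cgf\<close> presupposes the summability derived from here.\<close>

lemma moex_gf_sums:
  fixes q :: complex
  assumes "norm q < 1"
  obtains S where "(\<lambda>m. of_real (moex_weight m) * podC m q) sums S"
    and "(\<lambda>n. of_real (real (sigma_od_moex n)) * q ^ n) sums S"
proof -
  define r where "r = norm q"
  have r: "0 \<le> r" "r < 1" using assms by (auto simp: r_def)
  define f where "f = (\<lambda>(m, n). of_real (moex_weight m) * (of_real (real (pod_count m n)) * q ^ n))"
  define g where "g = (\<lambda>(m, n). moex_weight m * (real (pod_count m n) * r ^ n))"
  have "g summable_on UNIV \<times> UNIV"
  proof (rule summable_on_SigmaI)
    show "((\<lambda>n. g (m, n)) has_sum (moex_weight m * podR m r)) UNIV" for m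
      unfolding g_def prod.case pod.rgf_def using r summable_pod_count[OF r, of m]
      by (intro has_sum_cmult_right sums_nonneg_imp_has_sum summable_sums) auto
    have "summable (\<lambda>m. moex_weight m * podR m r)"
    proof (rule summable_comparison_test)
      show "summable (\<lambda>m. (2 * podR 0 r) * (1 / 2) ^ m)" by (intro summable_mult summable_geometric) simp
      have "moex_weight m * podR m r \<le> 2 * podR 0 r * (1 / 2) ^ m" for m
        unfolding podR_eq_odd_ratio[OF r, of m] mult.assoc
        using moex_weight_nonneg moex_weight_le odd_ratio_bounds[OF r] pod.rgf_nonneg[OF r]
        by (intro mult_mono mult_nonneg_nonneg mult_left_mono) auto
      thus "\<exists>M. \<forall>m\<ge>M. norm (moex_weight m * podR m r) \<le> 2 * podR 0 r * (1 / 2) ^ m"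
        using moex_weight_nonneg pod.rgf_nonneg[OF r] by (intro exI[of _ 0]) (simp add: abs_mult)
    qed
    thus "(\<lambda>m. moex_weight m * podR m r) summable_on UNIV"
      using moex_weight_nonneg pod.rgf_nonneg[OF r] by (intro summable_nonneg_imp_summable_on) auto
    show "g (m, n) \<ge> 0" for m n using r moex_weight_nonneg by (simp add: g_def)
  qed
  moreover have "norm (f x) = g x" for x
    using moex_weight_nonneg by (simp add: f_def g_def case_prod_unfold norm_mult norm_power r_def)
  ultimately have "(\<lambda>x. norm (f x)) summable_on UNIV \<times> UNIV" by (simp only:)
  hence "f summable_on UNIV \<times> UNIV" by (rule abs_summable_summable)
  then obtain S where S: "(f has_sum S) (UNIV \<times> UNIV)" by (auto simp: summable_on_def)
  have "((\<lambda>m. of_real (moex_weight m) * podC m q) has_sum S) UNIV"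
  proof (rule has_sum_SigmaD[OF S])
    show "((\<lambda>n. f (m, n)) has_sum (of_real (moex_weight m) * podC m q)) UNIV" for m
      unfolding f_def prod.case
      by (intro has_sum_cmult_right norm_summable_imp_has_sum pod.summable_norm_cgf pod.cgf_sums assms)
  qed
  moreover have "((\<lambda>n. of_real (real (sigma_od_moex n)) * q ^ n) has_sum S) UNIV"
  proof (rule has_sum_SigmaD[OF S[unfolded has_sum_swap[of f]]])
    show "((\<lambda>m. (\<lambda>(n, m). f (m, n)) (n, m)) has_sum (of_real (real (sigma_od_moex n)) * q ^ n)) UNIV" for n
    proof (rule has_sum_finite_neutralI[of "{..n}"])
      show "of_real (real (sigma_od_moex n)) * q ^ n = (\<Sum>m\<le>n. (\<lambda>(n, m). f (m, n)) (n, m))"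
        unfolding sigma_od_moex_eq_sum by (simp add: f_def sum_distrib_right mult.assoc)
      show "(\<lambda>(n, m). f (m, n)) (n, m) = 0" if "m \<in> UNIV - {..n}" for m
        using that pod_count_eq_0[of n m] by (simp add: f_def)
    qed auto
  qed
  ultimately show ?thesis using that by (blast intro: has_sum_imp_sums)
qed

lemma summable_sigma_od_moex:
  fixes r :: real
  assumes "0 \<le> r" "r < 1"
  shows "summable (\<lambda>n. real (sigma_od_moex n) * r ^ n)"
proof -
  obtain S where "(\<lambda>n. of_real (real (sigma_od_moex n)) * complex_of_real r ^ n) sums S"
    using moex_gf_sums[of "of_real r"] assms by auto
  hence "summable (\<lambda>n. complex_of_real (real (sigma_od_moex n) * r ^ n))"
    by (simp add: sums_iff)
  thus ?thesis by (simp only: summable_of_real_iff)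
qed

interpretation sigma: nonneg_power_series "\<lambda>n. real (sigma_od_moex n)"
proof (rule nonneg_power_series.intro)
  show "0 \<le> real (sigma_od_moex n)" for n by simp
  show "summable (\<lambda>n. real (sigma_od_moex n) * r ^ n)" if "0 \<le> r" "r < 1" for r
    using that by (rule summable_sigma_od_moex)
qed

lemma sigma_cgf_sums:
  assumes "norm q < 1"
  shows "(\<lambda>m. of_real (moex_weight m) * podC m q) sums sigma.cgf q"
  using moex_gf_sums[OF assms] sigma.cgf_sums[OF assms] by (metis sums_unique2)

lemma sigma_rgf_sums:
  assumes "0 \<le> r" "r < 1"
  shows "(\<lambda>m. moex_weight m * odd_ratio m r * podR 0 r) sums sigma.rgf r"
proof -
  have "(\<lambda>m. complex_of_real (moex_weight m * podR m r)) sums of_real (sigma.rgf r)"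
    using sigma_cgf_sums[of "of_real r"] assms by (simp add: pod.cgf_of_real sigma.cgf_of_real)
  hence "(\<lambda>m. moex_weight m * podR m r) sums sigma.rgf r" by (simp only: sums_of_real_iff)
  moreover have "moex_weight m * podR m r = moex_weight m * odd_ratio m r * podR 0 r" for m
    using podR_eq_odd_ratio[OF assms, of m] by simp
  ultimately show ?thesis by (simp only:)
qed

text \<open>Comparison with the term \<open>m = 0\<close>. It allows bounds relative to
  \<open>F\<^sub>0\<close> to be restated relative to the moex generating function.\<close>

lemma podR_0_le_sigma:
  assumes "0 \<le> r" "r < 1"
  shows "podR 0 r \<le> sigma.rgf r"
  unfolding pod.rgf_def sigma.rgf_def
proof (rule suminf_le)
  fix n
  have "real (pod_count 0 n) = moex_weight 0 * real (pod_count 0 n)" by (simp add: moex_weight_def)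
  also have "\<dots> \<le> real (sigma_od_moex n)" unfolding sigma_od_moex_eq_sum
    using moex_weight_nonneg by (intro member_le_sum) auto
  finally show "real (pod_count 0 n) * r ^ n \<le> real (sigma_od_moex n) * r ^ n"
    using assms by (intro mult_right_mono) auto
qed (use summable_pod_count summable_sigma_od_moex assms in auto)

lemma tendsto_sigma_over_podR:
  assumes "eventually (\<lambda>t. podR 0 (exp (- t)) > 0) (at_right 0)"
  shows "((\<lambda>t. sigma.rgf (exp (- t)) / podR 0 (exp (- t))) \<longlongrightarrow> 3) (at_right 0)"
proof -
  define a where "a = (\<lambda>m t. moex_weight m * odd_ratio m (exp (- t)))"
  have lim: "((\<lambda>t. a m t) \<longlongrightarrow> moex_weight m * (1 / 2) ^ m) (at_right 0)" for m
  proof -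
    have e: "((\<lambda>t::real. exp (- t)) \<longlongrightarrow> 1) (at_right 0)" by real_asymp
    have "((\<lambda>t. a m t) \<longlongrightarrow> moex_weight m * (\<Prod>j<m. 1 ^ (2 * j + 1) / (1 + 1 ^ (2 * j + 1)))) (at_right 0)"
      unfolding a_def odd_ratio_def by (intro tendsto_intros e) auto
    thus ?thesis by (simp add: power_divide)
  qed
  have bnd: "norm (a m t) \<le> 2 * (1 / 2) ^ m" if "t > 0" for m t
    using odd_ratio_bounds[of "exp (- t)" m] moex_weight_nonneg[of m] moex_weight_le[of m] that
    unfolding a_def by (auto simp: abs_mult intro!: mult_mono)
  have ev: "eventually (\<lambda>(m, t). norm (a m t) \<le> 2 * (1 / 2) ^ m) (at_top \<times>\<^sub>F at_right 0)"
    by (rule eventually_mono[OF eventually_prodI[OF always_eventually[of "\<lambda>_. True"] eventually_at_right_less[of 0]]])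
       (use bnd in auto)
  have geo: "(\<lambda>m. 2 * (1 / 2) ^ m :: real) sums (2 * (1 / (1 - 1 / 2)))"
    by (intro sums_mult geometric_sums) simp
  have 1: "((\<lambda>t. suminf (\<lambda>m. a m t)) \<longlongrightarrow> suminf (\<lambda>m. moex_weight m * (1 / 2) ^ m)) (at_right 0)"
    using tannerys_theorem[of a "\<lambda>m. moex_weight m * (1 / 2) ^ m" "at_right 0" "\<lambda>m. 2 * (1 / 2) ^ m", OF lim ev sums_summable[OF geo]]
    by simp
  \<comment> \<open>The full geometric series with weight 2 counts \<open>m = 0\<close> once too
    often, so the sum is \<open>4 - 1 = 3\<close>.\<close>
  have "(\<lambda>m. 2 * (1 / 2) ^ m - of_bool (m = 0) :: real) sums (2 * (1 / (1 - 1 / 2)) - 1)"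
    using sums_single[of 0 "\<lambda>_. 1 :: real"] by (intro sums_diff geo) (simp add: of_bool_def)
  moreover have "2 * (1 / 2) ^ m - of_bool (m = 0) = moex_weight m * (1 / 2) ^ m" for m
    by (simp add: moex_weight_def)
  ultimately have 2: "suminf (\<lambda>m. moex_weight m * (1 / 2) ^ m) = 3" by (simp add: sums_iff)
  have 3: "eventually (\<lambda>t. suminf (\<lambda>m. a m t) = sigma.rgf (exp (- t)) / podR 0 (exp (- t))) (at_right 0)"
    using assms eventually_at_right_less[of 0]
  proof eventually_elim
    case (elim t)
    have "(\<lambda>m. moex_weight m * odd_ratio m (exp (- t)) * podR 0 (exp (- t)) / podR 0 (exp (- t))) sums (sigma.rgf (exp (- t)) / podR 0 (exp (- t)))"
      using elim by (intro sums_divide sigma_rgf_sums) auto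
    thus ?case using elim by (simp add: a_def sums_iff)
  qed
  show ?thesis using 1 unfolding 2 by (subst (asm) tendsto_cong[OF 3])
qed

section \<open>Asymptotics of \<open>F\<^sub>0\<close> through three partition products\<close>

lemma prod_factor_0:
  fixes q :: real
  assumes "0 < q" "q < 1"
  shows "(\<Prod>k=1..2 * M. factor 0 k q) =
     (\<Prod>k=1..2 * M. 1 - (q\<^sup>2) ^ k) / ((\<Prod>k=1..M. 1 - (q ^ 4) ^ k) * (\<Prod>k=1..2 * M. 1 - q ^ k))"
proof (induction M)
  case (Suc M)
  define x where "x = q ^ (2 * M + 1)"
  define y where "y = q ^ (2 * M + 2)"
  have x: "0 < x" "x < 1" "0 < y" "y < 1" using assms by (auto simp: x_def y_def power_Suc_less_one power_less_one_iff simp del: power_Suc)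
  have e1: "(q\<^sup>2) ^ (2 * M + 1) = x\<^sup>2" "(q\<^sup>2) ^ (2 * M + 2) = y\<^sup>2" "(q ^ 4) ^ (M + 1) = y\<^sup>2"
  proof -
    have "4 * (M + 1) = (2 * M + 2) * 2" by simp
    thus "(q ^ 4) ^ (M + 1) = y\<^sup>2" by (simp only: y_def power_mult[symmetric])
  qed (simp_all only: x_def y_def power_mult[symmetric] mult.commute)
  have e2: "factor 0 (2 * M + 1) q = 1 + x" "factor 0 (2 * M + 2) q = 1 / (1 - y)"
    by (simp_all add: factor_def x_def y_def)
  have split: "(\<Prod>k=1..2 * Suc M. h k) = (\<Prod>k=1..2 * M. h k) * h (2 * M + 1) * h (2 * M + 2)" for h :: "nat \<Rightarrow> real"
    by simp
  have split1: "(\<Prod>k=1..Suc M. h k) = (\<Prod>k=1..M. h k) * h (M + 1)" for h :: "nat \<Rightarrow> real"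
    by simp
  have "(\<Prod>k=1..2 * Suc M. factor 0 k q) = (\<Prod>k=1..2 * M. factor 0 k q) * ((1 + x) * (1 / (1 - y)))"
    unfolding split e2 by (simp only: mult.assoc)
  \<comment> \<open>The odd factor is \<open>1 + x = (1 - x\<^sup>2) / (1 - x)\<close>. The even one
    is extended by \<open>1 - y\<^sup>2\<close>, which completes the product in
    \<open>q\<^sup>2\<close> and leaves the product in \<open>q ^ 4\<close> in the
    denominator.\<close>
  also have "(1 + x) * (1 / (1 - y)) = ((1 - x\<^sup>2) * (1 - y\<^sup>2)) / ((1 - y\<^sup>2) * ((1 - x) * (1 - y)))"
  proof -
    have "y\<^sup>2 \<noteq> 1" using x by (simp add: power2_eq_1_iff)
    moreover have "1 - x\<^sup>2 = (1 - x) * (1 + x)" by (simp add: power2_eq_square algebra_simps)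
    ultimately show ?thesis using x by (simp only:) simp
  qed
  finally show ?case
    unfolding Suc.IH split split1 e1 x_def[symmetric] y_def[symmetric] by (simp only: times_divide_times_eq mult_ac)
qed simp

lemma podR_0_eq:
  assumes "t > 0"
  shows "podR 0 (exp (- t)) = exp (lnP t + lnP (4 * t) - lnP (2 * t))"
proof -
  define q where "q = exp (- t)"
  have q: "0 < q" "q < 1" using assms by (auto simp: q_def)
  have q2: "exp (- (2 * t)) = q\<^sup>2" and q4: "exp (- (4 * t)) = q ^ 4"
    unfolding q_def by (simp_all flip: exp_of_nat_mult)
  have dbl: "filterlim (\<lambda>M::nat. 2 * M) sequentially sequentially"
    by (rule mult_nat_left_at_top) simp
  have "(\<lambda>M. (\<Prod>k=1..2 * M. 1 - (q\<^sup>2) ^ k) / ((\<Prod>k=1..M. 1 - (q ^ 4) ^ k) * (\<Prod>k=1..2 * M. 1 - q ^ k)))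
     \<longlonglongrightarrow> exp (- lnP (2 * t)) / (exp (- lnP (4 * t)) * exp (- lnP t))"
    using tendsto_exp_lnP[of "4 * t"] filterlim_compose[OF tendsto_exp_lnP[of "2 * t"] dbl]
      filterlim_compose[OF tendsto_exp_lnP[of t] dbl] assms
    unfolding q2 q4 q_def[symmetric] by (intro tendsto_divide tendsto_mult) auto
  hence "(\<lambda>M. \<Prod>k=1..2 * M. factor 0 k q) \<longlonglongrightarrow> exp (- lnP (2 * t)) / (exp (- lnP (4 * t)) * exp (- lnP t))"
    by (simp only: prod_factor_0[OF q])
  moreover have "(\<lambda>M. \<Prod>k=1..2 * M. factor 0 k q) \<longlonglongrightarrow> podR 0 q"
    by (rule filterlim_compose[OF tendsto_prod_factor_real dbl]) (use q in auto)
  ultimately have "podR 0 q = exp (- lnP (2 * t)) / (exp (- lnP (4 * t)) * exp (- lnP t))"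
    by (metis LIMSEQ_unique)
  also have "\<dots> = exp (lnP t + lnP (4 * t) - lnP (2 * t))"
    by (simp add: exp_minus exp_add exp_diff field_simps)
  finally show ?thesis by (simp only: q_def)
qed

lemma podR_0_asymptotics:
  "((\<lambda>t. podR 0 (exp (- t)) / (1 / sqrt pi * sqrt t * exp (pi\<^sup>2 / 8 / t))) \<longlongrightarrow> 1) (at_right 0)"
proof -
  define e where "e = (\<lambda>t. lnP t - pi\<^sup>2 / (6 * t) - ln (t / (2 * pi)) / 2)"
  have lim: "((\<lambda>t. e (c * t)) \<longlongrightarrow> 0) (at_right 0)" if "c > 0" for c :: real
  proof -
    have "filterlim (\<lambda>t. c * t) (at_right 0) (at_right 0)" using that by real_asymp
    from filterlim_compose[OF lnP_asymptotics[folded e_def] this] show ?thesis .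
  qed
  have "((\<lambda>t. exp (e (1 * t) + e (4 * t) - e (2 * t))) \<longlongrightarrow> exp (0 + 0 - 0)) (at_right 0)"
    by (intro tendsto_intros lim) auto
  moreover have "eventually (\<lambda>t. exp (e (1 * t) + e (4 * t) - e (2 * t)) = podR 0 (exp (- t)) / (1 / sqrt pi * sqrt t * exp (pi\<^sup>2 / 8 / t))) (at_right 0)"
    using eventually_at_right_less[of 0]
  proof eventually_elim
    case (elim t)
    \<comment> \<open>Combining the arguments \<open>t\<close>, \<open>4 * t\<close> and
      \<open>2 * t\<close> gives the prefactor \<open>sqrt (t / pi)\<close> here, and below the
      exponent \<open>1 / 6 * (1 + 1 / 4 - 1 / 2) = 1 / 8\<close>.\<close>
    have l: "ln (t / (2 * pi)) / 2 + ln (4 * t / (2 * pi)) / 2 - ln (2 * t / (2 * pi)) / 2 = ln (1 / sqrt pi * sqrt t)"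
    proof -
      have "ln (4::real) = 2 * ln 2" using ln_realpow[of 2 2] by simp
      thus ?thesis using elim by (simp add: ln_div ln_mult ln_sqrt field_simps)
    qed
    have p: "pi\<^sup>2 / (6 * t) + pi\<^sup>2 / (6 * (4 * t)) - pi\<^sup>2 / (6 * (2 * t)) = pi\<^sup>2 / 8 / t"
      using elim by (simp add: field_simps)
    have "e (1 * t) + e (4 * t) - e (2 * t) = (lnP t + lnP (4 * t) - lnP (2 * t)) - ln (1 / sqrt pi * sqrt t) - pi\<^sup>2 / 8 / t"
      unfolding l[symmetric] p[symmetric] by (simp add: e_def)
    also have "exp \<dots> = podR 0 (exp (- t)) / exp (ln (1 / sqrt pi * sqrt t)) / exp (pi\<^sup>2 / 8 / t)"
      unfolding podR_0_eq[OF elim] by (simp only: exp_diff)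
    also have "exp (ln (1 / sqrt pi * sqrt t)) = 1 / sqrt pi * sqrt t" using elim by (intro exp_ln) simp
    finally show ?case by simp
  qed
  ultimately show ?thesis by (simp add: tendsto_cong)
qed

section \<open>Saddle point bounds\<close>

lemma half_le_sin:
  assumes "0 \<le> x" "x \<le> pi / 2"
  shows "x / 2 \<le> sin x"
proof -
  have "\<bar>sin x - (\<Sum>m<3. sin_coeff m * x ^ m)\<bar> \<le> inverse (fact 3) * \<bar>x\<bar> ^ 3" by (rule Maclaurin_sin_bound)
  moreover have "(\<Sum>m<3. sin_coeff m * x ^ m) = x" by (simp add: eval_nat_numeral sin_coeff_def)
  moreover have "inverse (fact 3) * \<bar>x\<bar> ^ 3 \<le> x / 2"
  proof -
    have "pi \<le> 16 / 5" using pi_approx(2) by simp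
    hence "x \<le> 8 / 5" using assms by linarith
    hence "x\<^sup>2 \<le> (8 / 5)\<^sup>2" using assms by (intro power_mono) auto
    hence "x\<^sup>2 \<le> 3" by (simp add: power2_eq_square)
    hence "x * x\<^sup>2 \<le> x * 3" using assms by (intro mult_left_mono) auto
    thus ?thesis using assms by (simp add: eval_nat_numeral)
  qed
  ultimately show ?thesis by linarith
qed

lemma one_minus_cos_ge:
  assumes "\<bar>x\<bar> \<le> pi"
  shows "x\<^sup>2 / 8 \<le> 1 - cos x"
proof -
  have "\<bar>x\<bar> / 2 / 2 \<le> sin (\<bar>x\<bar> / 2)" using assms by (intro half_le_sin) auto
  hence "(\<bar>x\<bar> / 2 / 2)\<^sup>2 \<le> (sin (\<bar>x\<bar> / 2))\<^sup>2" by (intro power_mono) auto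
  moreover have "cos (2 * (\<bar>x\<bar> / 2)) = 1 - 2 * (sin (\<bar>x\<bar> / 2))\<^sup>2" by (rule cos_double_sin)
  ultimately show ?thesis by (simp add: power_divide)
qed

text \<open>The cube of \<open>u \<le> exp u\<close> at \<open>u = k / (3 * t)\<close>. The power 3
  is that of the saddle decay \<open>1 / (1 + \<theta>\<^sup>2 / t ^ 3)\<close>, into which
  exponentially small terms are absorbed.\<close>

lemma exp_neg_inverse_le_cube:
  fixes k t :: real
  assumes "k > 0" "t > 0"
  shows "exp (- (k / t)) \<le> (3 / k) ^ 3 * t ^ 3"
proof -
  have "k / (3 * t) \<le> exp (k / (3 * t))" using exp_ge_add_one_self[of "k / (3 * t)"] by linarith
  hence "(k / (3 * t)) ^ 3 \<le> exp (k / (3 * t)) ^ 3" using assms by (intro power_mono) auto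
  also have "exp (k / (3 * t)) ^ 3 = exp (k / t)" by (simp flip: exp_of_nat_mult)
  finally have "1 / exp (k / t) \<le> 1 / (k / (3 * t)) ^ 3" using assms by (intro divide_left_mono) auto
  thus ?thesis using assms by (simp add: exp_minus field_simps power_divide power_mult_distrib)
qed

lemma cube_le_saddle_decay:
  fixes t \<theta> :: real
  assumes "0 < t" "t < 1" "\<bar>\<theta>\<bar> \<le> pi"
  shows "t ^ 3 \<le> 17 / (1 + \<theta>\<^sup>2 / t ^ 3)"
proof -
  \<comment> \<open>The constant 17 is \<open>1 + 4\<^sup>2\<close>, from \<open>t < 1\<close> and
    \<open>pi < 4\<close>.\<close>
  have "\<theta>\<^sup>2 \<le> 4\<^sup>2" using assms pi_less_4 by (intro abs_le_square_iff[THEN iffD1]) auto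
  moreover have "t ^ 3 \<le> 1" using assms by (intro power_le_one) auto
  moreover have "t ^ 3 * (1 + \<theta>\<^sup>2 / t ^ 3) = t ^ 3 + \<theta>\<^sup>2" using assms by (simp add: distrib_left)
  ultimately have "t ^ 3 * (1 + \<theta>\<^sup>2 / t ^ 3) \<le> 17" by simp
  moreover have "0 < 1 + \<theta>\<^sup>2 / t ^ 3" using assms by (intro add_pos_nonneg) auto
  ultimately show ?thesis by (simp add: pos_le_divide_eq)
qed

text \<open>Write \<open>R\<^sup>2 = a\<^sup>2 + w\<close> with
  \<open>a = 1 - exp (- t) \<le> t\<close>. Then \<open>1 / a - 1 / R = w / (a * R * (R + a)) \<ge>
  w / (2 * a * R\<^sup>2)\<close>, which is monotone in \<open>a\<close> and \<open>w\<close>, so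
  bounds for these two suffice.\<close>

lemma pole_gap_ge:
  fixes t \<theta> :: real
  assumes t: "0 < t" "t < 1" and \<theta>: "\<bar>\<theta>\<bar> \<le> pi"
  defines "q \<equiv> exp (of_real (- t) + \<i> * of_real \<theta>)"
  shows "\<theta>\<^sup>2 / (2 * t * (12 * t\<^sup>2 + \<theta>\<^sup>2)) \<le> 1 / (1 - exp (- t)) - 1 / norm (1 - q)"
proof -
  define r where "r = exp (- t)"
  define a where "a = 1 - r"
  define R where "R = norm (1 - q)"
  define w where "w = 2 * r * (1 - cos \<theta>)"
  have r: "0 < r" "r < 1" using t by (auto simp: r_def)
  have a: "0 < a" "a \<le> t" using r exp_ge_add_one_self[of "- t"] by (auto simp: a_def r_def)
  have q: "q = of_real r * cis \<theta>"
    unfolding q_def r_def exp_add cis_conv_exp by (simp add: exp_of_real mult.commute flip: exp_of_real of_real_minus)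
  have R2: "R\<^sup>2 = a\<^sup>2 + w"
  proof -
    have "R\<^sup>2 = (1 - r * cos \<theta>)\<^sup>2 + (r * sin \<theta>)\<^sup>2"
      unfolding R_def cmod_power2 q by simp
    also have "\<dots> = 1 - 2 * r * cos \<theta> + r\<^sup>2 * ((cos \<theta>)\<^sup>2 + (sin \<theta>)\<^sup>2)"
      by algebra
    finally have "R\<^sup>2 = 1 - 2 * r * cos \<theta> + r\<^sup>2" by simp
    thus ?thesis by (simp add: a_def w_def power2_eq_square algebra_simps)
  qed
  \<comment> \<open>The constant 12 comes from \<open>2 * (1 / 3) * (1 / 8)\<close>, with
    \<open>r \<ge> exp (-1) \<ge> 1 / 3\<close> and
    \<open>1 - cos \<theta> \<ge> \<theta>\<^sup>2 / 8\<close>.\<close>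
  have w: "\<theta>\<^sup>2 / 12 \<le> w"
  proof -
    have "1 / 3 \<le> exp (- (1::real))" using e_less_272 by (simp add: exp_minus field_simps)
    also have "\<dots> \<le> r" using t by (simp add: r_def)
    finally have "2 * (1 / 3) * (\<theta>\<^sup>2 / 8) \<le> 2 * r * (1 - cos \<theta>)"
      using one_minus_cos_ge[OF \<theta>] r by (intro mult_mono) auto
    thus ?thesis by (simp add: w_def)
  qed
  hence w0: "0 \<le> w" using zero_le_power2[of \<theta>] by linarith
  have Ra: "a \<le> R" by (rule power2_le_imp_le) (use R2 w0 in \<open>auto simp: R_def\<close>)
  have R: "0 < R" using a Ra by linarith
  have "\<theta>\<^sup>2 / (2 * t * (12 * t\<^sup>2 + \<theta>\<^sup>2)) = (\<theta>\<^sup>2 / 12) / (2 * t * (t\<^sup>2 + \<theta>\<^sup>2 / 12))"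
    using t by (simp add: field_simps)
  also have "\<dots> = 1 / (2 * t) * ((\<theta>\<^sup>2 / 12) / (t\<^sup>2 + \<theta>\<^sup>2 / 12))" by simp
  also have "\<dots> \<le> 1 / (2 * a) * (w / (a\<^sup>2 + w))"
  proof (rule mult_mono)
    have "a\<^sup>2 * (\<theta>\<^sup>2 / 12) \<le> t\<^sup>2 * w" using a w by (intro mult_mono power_mono) auto
    moreover have "0 < t\<^sup>2 + \<theta>\<^sup>2 / 12" "0 < a\<^sup>2 + w" using t a w0 by (auto intro!: add_pos_nonneg)
    ultimately show "(\<theta>\<^sup>2 / 12) / (t\<^sup>2 + \<theta>\<^sup>2 / 12) \<le> w / (a\<^sup>2 + w)"
      by (simp add: divide_le_eq pos_le_divide_eq mult.commute) (simp add: field_simps)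
  qed (use a t w0 in \<open>auto intro!: frac_le\<close>)
  also have "\<dots> = w / (2 * a * R\<^sup>2)" by (simp add: R2)
  also have "\<dots> \<le> w / (a * R * (R + a))"
  proof (rule divide_left_mono[OF _ w0])
    have "a * R * (R + a) \<le> a * R * (2 * R)" using a R Ra by (intro mult_left_mono) auto
    thus "a * R * (R + a) \<le> 2 * a * R\<^sup>2" by (simp add: power2_eq_square)
    show "0 < 2 * a * R\<^sup>2 * (a * R * (R + a))" using a R by simp
  qed
  also have "w = (R - a) * (R + a)" using R2 by (simp add: power2_eq_square algebra_simps)
  also have "(R - a) * (R + a) / (a * R * (R + a)) = 1 / a - 1 / R"
  proof -
    have "R + a \<noteq> 0" using a R by linarith
    hence "(R - a) * (R + a) / (a * R * (R + a)) = (R - a) / (a * R)" by simp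
    also have "\<dots> = 1 / a - 1 / R" using a R by (simp add: diff_divide_distrib)
    finally show ?thesis .
  qed
  finally show ?thesis by (simp only: a_def R_def r_def)
qed

text \<open>For \<bar>\<theta>\<bar> \<le> t the gap is at least \<open>z / 26\<close>, and
  \<open>exp u \<ge> 1 + u\<close> suffices. Otherwise the gap is at least
  \<open>1 / (26 * t)\<close>, and the exponential is below a multiple of \<open>t ^ 3\<close>. Here
  \<open>26 = 2 * (12 + 1)\<close>.\<close>

lemma exp_pole_gap_le:
  fixes c :: real
  assumes c: "0 < c" "c \<le> 1"
  obtains C where "\<And>t \<theta>. 0 < t \<Longrightarrow> t < 1 \<Longrightarrow> \<bar>\<theta>\<bar> \<le> pi \<Longrightarrow>
    exp (- (c * (1 / (1 - exp (- t)) - 1 / norm (1 - exp (of_real (- t) + \<i> * of_real \<theta>))))) \<le> C / (1 + \<theta>\<^sup>2 / t ^ 3)"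
proof
  fix t \<theta> :: real assume t: "0 < t" "t < 1" "\<bar>\<theta>\<bar> \<le> pi"
  define G where "G = 1 / (1 - exp (- t)) - 1 / norm (1 - exp (of_real (- t) + \<i> * of_real \<theta>))"
  define z where "z = \<theta>\<^sup>2 / t ^ 3"
  let ?C = "26 / c + (3 / (c / 26)) ^ 3 * 17"
  have z: "0 \<le> z" using t by (simp add: z_def)
  have G: "\<theta>\<^sup>2 / (2 * t * (12 * t\<^sup>2 + \<theta>\<^sup>2)) \<le> G" unfolding G_def by (rule pole_gap_ge[OF t])
  have "exp (- (c * G)) \<le> ?C / (1 + z)"
  proof (cases "\<theta>\<^sup>2 \<le> t\<^sup>2")
    case True
    have "z / 26 = \<theta>\<^sup>2 / (2 * t * (13 * t\<^sup>2))" by (simp add: z_def power2_eq_square power3_eq_cube)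
    also have "\<dots> \<le> \<theta>\<^sup>2 / (2 * t * (12 * t\<^sup>2 + \<theta>\<^sup>2))"
      using True t by (intro divide_left_mono mult_left_mono mult_pos_pos add_pos_nonneg) auto
    also note G
    finally have "c * (z / 26) \<le> c * G" using c by (intro mult_left_mono) auto
    moreover have "1 + c * (z / 26) \<le> exp (c * (z / 26))" by (rule exp_ge_add_one_self)
    moreover have "c / 26 * (1 + z) \<le> 1 + c * (z / 26)" using c by (simp add: algebra_simps)
    ultimately have "c / 26 * (1 + z) \<le> exp (c * G)" by (smt (verit) exp_le_cancel_iff)
    moreover have "0 < c / 26 * (1 + z)" using c z by simp
    ultimately have "1 / exp (c * G) \<le> 1 / (c / 26 * (1 + z))" by (intro frac_le) auto
    also have "\<dots> = 26 / c / (1 + z)" by simp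
    also have "\<dots> \<le> ?C / (1 + z)" using c z by (intro divide_right_mono) auto
    finally show ?thesis by (simp add: exp_minus inverse_eq_divide)
  next
    case False
    have "1 / 26 / t \<le> \<theta>\<^sup>2 / (2 * t * (12 * t\<^sup>2 + \<theta>\<^sup>2))"
    proof -
      have "12 * t\<^sup>2 + \<theta>\<^sup>2 \<le> 13 * \<theta>\<^sup>2" using False by linarith
      moreover have "0 < 12 * t\<^sup>2 + \<theta>\<^sup>2" using t by (intro add_pos_nonneg) auto
      ultimately have "1 / 13 \<le> \<theta>\<^sup>2 / (12 * t\<^sup>2 + \<theta>\<^sup>2)" by (simp add: pos_le_divide_eq)
      hence "1 / (2 * t) * (1 / 13) \<le> 1 / (2 * t) * (\<theta>\<^sup>2 / (12 * t\<^sup>2 + \<theta>\<^sup>2))" using t by (intro mult_left_mono) auto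
      thus ?thesis by simp
    qed
    hence "c * (1 / 26 / t) \<le> c * G" using G c by (intro mult_left_mono) auto
    hence "exp (- (c * G)) \<le> exp (- (c / 26 / t))" by simp
    also have "\<dots> \<le> (3 / (c / 26)) ^ 3 * t ^ 3" using c t by (intro exp_neg_inverse_le_cube) auto
    also have "\<dots> \<le> (3 / (c / 26)) ^ 3 * (17 / (1 + z))"
      unfolding z_def using c t by (intro mult_left_mono cube_le_saddle_decay) auto
    also have "\<dots> = (3 / (c / 26)) ^ 3 * 17 / (1 + z)" by simp
    also have "\<dots> \<le> ?C / (1 + z)" using c z by (intro divide_right_mono) auto
    finally show ?thesis .
  qed
  thus "exp (- (c * (1 / (1 - exp (- t)) - 1 / norm (1 - exp (of_real (- t) + \<i> * of_real \<theta>))))) \<le> ?C / (1 + \<theta>\<^sup>2 / t ^ 3)"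
    by (simp only: G_def z_def)
qed

text \<open>For \<open>m \<le> 1 / t\<close> the decay away from the real axis comes from the product bound, for larger \<open>m\<close>
  the factor \<open>2 ^ (- m)\<close> is already exponentially small.\<close>
lemma norm_podC_le_saddle:
  obtains C where "\<And>m t \<theta>. 0 < t \<Longrightarrow> t < 1 \<Longrightarrow> \<bar>\<theta>\<bar> \<le> pi \<Longrightarrow>
    norm (podC m (exp (of_real (- t) + \<i> * of_real \<theta>))) \<le> C * podR 0 (exp (- t)) / (1 + \<theta>\<^sup>2 / t ^ 3) * sqrt (1 / 2) ^ m"
proof -
  \<comment> \<open>For \<open>m * t \<le> 1\<close> one has \<open>(2 * m + 1) * t \<le> 3\<close>,
    so \<open>r ^ (2 * m + 1) \<ge> exp (- 3)\<close>; the 4 is the denominator in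
    \<open>norm_podC_le\<close>.\<close>
  define c where "c = exp (- 3) / (4::real)"
  have c: "0 < c" "c \<le> 1" by (auto simp: c_def intro: order_trans[of _ "1::real"])
  obtain C where C: "\<And>t \<theta>. 0 < t \<Longrightarrow> t < 1 \<Longrightarrow> \<bar>\<theta>\<bar> \<le> pi \<Longrightarrow>
    exp (- (c * (1 / (1 - exp (- t)) - 1 / norm (1 - exp (of_real (- t) + \<i> * of_real \<theta>))))) \<le> C / (1 + \<theta>\<^sup>2 / t ^ 3)"
    using exp_pole_gap_le[OF c] by blast
  define k where "k = ln 2 / (2::real)"
  have k: "k > 0" by (simp add: k_def)
  define C' where "C' = \<bar>C\<bar> + (3 / k) ^ 3 * 17"
  have sq: "sqrt (1 / 2) = exp (- k)"
  proof -
    have "exp (- k) ^ 2 = 1 / 2" 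
      unfolding exp_double[symmetric] by (simp add: k_def exp_minus)
    thus ?thesis by (metis exp_ge_zero real_sqrt_unique)
  qed
  show ?thesis
  proof (rule that[of C'])
    fix m :: nat and t \<theta> :: real
    assume t: "0 < t" "t < 1" "\<bar>\<theta>\<bar> \<le> pi"
    define q where "q = exp (of_real (- t) + \<i> * of_real \<theta>)"
    define r where "r = exp (- t)"
    define G where "G = 1 / (1 - r) - 1 / norm (1 - q)"
    define D where "D = 1 + \<theta>\<^sup>2 / t ^ 3"
    have D: "D > 0" unfolding D_def using t by (intro add_pos_nonneg) auto
    have r: "0 \<le> r" "r < 1" using t by (auto simp: r_def)
    have nq: "norm q = r" by (simp add: q_def r_def)
    have G0: "0 \<le> G"
    proof -
      have "0 \<le> \<theta>\<^sup>2 / (2 * t * (12 * t\<^sup>2 + \<theta>\<^sup>2))" using t by simp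
      also have "\<dots> \<le> G" unfolding G_def q_def r_def by (rule pole_gap_ge[OF t])
      finally show ?thesis .
    qed
    have P: "0 \<le> podR 0 r" by (rule pod.rgf_nonneg[OF r])
    \<comment> \<open>One square root is kept to make the bounds summable over \<open>m\<close>; for
      large \<open>m\<close> the other one supplies the saddle decay.\<close>
    have half: "(1 / 2 :: real) ^ m = sqrt (1 / 2) ^ m * sqrt (1 / 2) ^ m"
      by (simp flip: power_mult_distrib)
    have s1: "sqrt (1 / 2) ^ m \<le> 1" by (intro power_le_one) auto
    have b: "norm (podC m q) \<le> podR 0 r * (1 / 2) ^ m * exp (- (r ^ (2 * m + 1) * G / 4))"
    proof -
      have "norm (podC m q) \<le> podR m r * exp (- (r ^ (2 * m + 1) * G / 4))"
        using norm_podC_le[of q m] r unfolding nq G_def by simp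
      also have "\<dots> \<le> podR 0 r * (1 / 2) ^ m * exp (- (r ^ (2 * m + 1) * G / 4))"
        unfolding podR_eq_odd_ratio[OF r, of m] using odd_ratio_bounds[OF r, of m] P
        by (intro mult_right_mono mult_left_mono) auto
      finally show ?thesis .
    qed
    have "(1 / 2) ^ m * exp (- (r ^ (2 * m + 1) * G / 4)) \<le> sqrt (1 / 2) ^ m * (C' / D)"
    proof (cases "real m * t \<le> 1")
      case True
      have "exp (- 3) \<le> r ^ (2 * m + 1)"
      proof -
        have "real (2 * m + 1) * t \<le> 3" using True t by (simp add: algebra_simps)
        hence "exp (- 3) \<le> exp (- (real (2 * m + 1) * t))" by simp
        also have "\<dots> = r ^ (2 * m + 1)" unfolding r_def by (rule exp_minus_mult_eq_power)
        finally show ?thesis .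
      qed
      hence "exp (- 3) * G \<le> r ^ (2 * m + 1) * G" by (rule mult_right_mono[OF _ G0])
      hence "exp (- (r ^ (2 * m + 1) * G / 4)) \<le> exp (- (c * G))" by (simp add: c_def)
      also have "\<dots> \<le> C / D" unfolding G_def D_def q_def r_def by (rule C[OF t])
      also have "\<dots> \<le> C' / D" unfolding C'_def using D k by (intro divide_right_mono) (auto intro: add_increasing2)
      finally have e: "exp (- (r ^ (2 * m + 1) * G / 4)) \<le> C' / D" .
      have "(1 / 2 :: real) ^ m \<le> sqrt (1 / 2) ^ m"
        unfolding half using s1 by (intro mult_left_le) auto
      thus ?thesis using e by (intro mult_mono) auto
    next
      case False
      have "1 / t \<le> real m" using False t by (simp add: field_simps)
      hence "k * (1 / t) \<le> k * real m" using k by (intro mult_left_mono) auto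
      hence "exp (- (real m * k)) \<le> exp (- (k / t))" by (simp add: mult.commute)
      hence "sqrt (1 / 2) ^ m \<le> exp (- (k / t))" unfolding sq exp_minus_mult_eq_power .
      also have "\<dots> \<le> (3 / k) ^ 3 * t ^ 3" using k t by (intro exp_neg_inverse_le_cube) auto
      also have "\<dots> \<le> (3 / k) ^ 3 * (17 / D)"
        unfolding D_def using k t by (intro mult_left_mono cube_le_saddle_decay) auto
      also have "\<dots> = (3 / k) ^ 3 * 17 / D" by simp
      also have "\<dots> \<le> C' / D" unfolding C'_def using D by (intro divide_right_mono) auto
      finally have e: "sqrt (1 / 2) ^ m \<le> C' / D" .
      have "(1 / 2) ^ m * exp (- (r ^ (2 * m + 1) * G / 4)) \<le> (1 / 2) ^ m * 1"
        using r G0 by (intro mult_left_mono) auto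
      also have "\<dots> \<le> sqrt (1 / 2) ^ m * (C' / D)" unfolding half mult_1_right by (rule mult_left_mono[OF e]) simp
      finally show ?thesis .
    qed
    from mult_left_mono[OF this P] b
    have "norm (podC m q) \<le> podR 0 r * (sqrt (1 / 2) ^ m * (C' / D))" by (simp only: mult.assoc)
    also have "\<dots> = C' * podR 0 r / D * sqrt (1 / 2) ^ m" by simp
    finally show "norm (podC m (exp (of_real (- t) + \<i> * of_real \<theta>))) \<le> C' * podR 0 (exp (- t)) / (1 + \<theta>\<^sup>2 / t ^ 3) * sqrt (1 / 2) ^ m"
      by (simp only: q_def r_def D_def)
  qed
qed

text \<open>The termwise bounds are summed over \<open>m\<close>: the weights are at most 2, and the
  powers of \<open>sqrt (1 / 2)\<close> form a geometric series.\<close>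

lemma norm_sigma_cgf_le_saddle:
  obtains C where "\<And>t \<theta>. 0 < t \<Longrightarrow> t < 1 \<Longrightarrow> \<bar>\<theta>\<bar> \<le> pi \<Longrightarrow>
    norm (sigma.cgf (exp (of_real (- t) + \<i> * of_real \<theta>))) \<le> C * sigma.rgf (exp (- t)) / (1 + \<theta>\<^sup>2 / t ^ 3)"
proof -
  obtain C where C: "\<And>m t \<theta>. 0 < t \<Longrightarrow> t < 1 \<Longrightarrow> \<bar>\<theta>\<bar> \<le> pi \<Longrightarrow>
    norm (podC m (exp (of_real (- t) + \<i> * of_real \<theta>))) \<le> C * podR 0 (exp (- t)) / (1 + \<theta>\<^sup>2 / t ^ 3) * sqrt (1 / 2) ^ m"
    using norm_podC_le_saddle by blast
  define s where "s = sqrt (1 / 2 :: real)"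
  have s: "0 < s" "s < 1" by (auto simp: s_def real_sqrt_less_iff)
  show ?thesis
  proof (rule that[of "2 / (1 - s) * \<bar>C\<bar>"])
    fix t \<theta> :: real assume t: "0 < t" "t < 1" "\<bar>\<theta>\<bar> \<le> pi"
    define q where "q = exp (of_real (- t) + \<i> * of_real \<theta>)"
    define r where "r = exp (- t)"
    define D where "D = 1 + \<theta>\<^sup>2 / t ^ 3"
    have D: "D > 0" unfolding D_def using t by (intro add_pos_nonneg) auto
    have r: "0 \<le> r" "r < 1" using t by (auto simp: r_def)
    have nq: "norm q < 1" using t by (simp add: q_def)
    define B where "B = \<bar>C\<bar> * sigma.rgf r / D"
    have B: "norm (podC m q) \<le> B * s ^ m" for m
    proof -
      have "norm (podC m q) \<le> C * podR 0 r / D * s ^ m" unfolding q_def r_def D_def s_def by (rule C[OF t])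
      also have "\<dots> \<le> \<bar>C\<bar> * sigma.rgf r / D * s ^ m"
        using D s podR_0_le_sigma[OF r] pod.rgf_nonneg[OF r, of 0]
        by (intro mult_right_mono divide_right_mono mult_mono) auto
      finally show ?thesis by (simp only: B_def)
    qed
    have B0: "0 \<le> B" unfolding B_def using D sigma.rgf_nonneg[OF r] by simp
    have bnd: "norm (of_real (moex_weight m) * podC m q) \<le> 2 * B * s ^ m" for m
    proof -
      have "norm (of_real (moex_weight m) * podC m q) = moex_weight m * norm (podC m q)"
        using moex_weight_nonneg[of m] by (simp add: norm_mult)
      also have "\<dots> \<le> 2 * (B * s ^ m)" using moex_weight_nonneg moex_weight_le B by (intro mult_mono) auto
      finally show ?thesis by simp
    qed
    have geo: "(\<lambda>m. 2 * B * s ^ m) sums (2 * B * (1 / (1 - s)))"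
      using s by (intro sums_mult geometric_sums) auto
    have "norm (sigma.cgf q) \<le> 2 * B * (1 / (1 - s))"
      using norm_sums_le[OF sigma_cgf_sums[OF nq] geo bnd] .
    also have "\<dots> = 2 / (1 - s) * \<bar>C\<bar> * sigma.rgf r / D" by (simp add: B_def mult_ac)
    finally show "norm (sigma.cgf (exp (of_real (- t) + \<i> * of_real \<theta>))) \<le> 2 / (1 - s) * \<bar>C\<bar> * sigma.rgf (exp (- t)) / (1 + \<theta>\<^sup>2 / t ^ 3)"
      by (simp only: q_def r_def D_def)
  qed
qed

lemma sigma_asymptotics:
  "((\<lambda>t. sigma.rgf (exp (- t)) / (3 / sqrt pi * sqrt t * exp (pi\<^sup>2 / 8 / t))) \<longlongrightarrow> 1) (at_right 0)"
proof -
  have "((\<lambda>t. sigma.rgf (exp (- t)) / podR 0 (exp (- t)) * (podR 0 (exp (- t)) / (1 / sqrt pi * sqrt t * exp (pi\<^sup>2 / 8 / t))) / 3)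
      \<longlongrightarrow> 3 * 1 / 3) (at_right 0)"
    by (intro tendsto_divide tendsto_mult tendsto_sigma_over_podR podR_0_asymptotics tendsto_const)
       (auto intro: eventually_mono[OF eventually_at_right_less[of 0]] simp: podR_0_eq)
  moreover have "eventually (\<lambda>t. sigma.rgf (exp (- t)) / podR 0 (exp (- t)) * (podR 0 (exp (- t)) / (1 / sqrt pi * sqrt t * exp (pi\<^sup>2 / 8 / t))) / 3
      = sigma.rgf (exp (- t)) / (3 / sqrt pi * sqrt t * exp (pi\<^sup>2 / 8 / t))) (at_right 0)"
    using eventually_at_right_less[of 0]
  proof eventually_elim
    case (elim t)
    have "podR 0 (exp (- t)) \<noteq> 0" by (simp add: podR_0_eq[OF elim])
    thus ?case by simp
  qed
  ultimately show ?thesis by (simp add: tendsto_cong)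
qed

theorem theorem1p7:
  "(\<lambda>n. real (sigma_od_moex n)) \<sim>[at_top]
     (\<lambda>n. 3 * exp (pi * sqrt (real n / 2)) / (4 * sqrt 2 * real n))"
proof -
  obtain C where C: "\<And>t \<theta>. 0 < t \<Longrightarrow> t < 1 \<Longrightarrow> \<bar>\<theta>\<bar> \<le> pi \<Longrightarrow>
    norm (sigma.cgf (exp (of_real (- t) + \<i> * of_real \<theta>))) \<le> C * sigma.rgf (exp (- t)) / (1 + \<theta>\<^sup>2 / t ^ 3)"
    using norm_sigma_cgf_le_saddle by blast
  \<comment> \<open>The saddle point theorem is applied with \<open>A = pi\<^sup>2 / 8\<close> and
    \<open>K = 3 / sqrt pi\<close>; what follows only simplifies the constants.\<close>
  have "(\<lambda>n. real (sigma_od_moex n)) \<sim>[at_top]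
      (\<lambda>n. 3 / sqrt pi * sqrt (pi\<^sup>2 / 8 / pi) / (2 * real n) * exp (2 * sqrt (pi\<^sup>2 / 8 * real n)))"
    by (rule sigma.coefficient_asymptotics[OF _ _ zero_less_one sigma_asymptotics C]) auto
  also have "(\<lambda>n. 3 / sqrt pi * sqrt (pi\<^sup>2 / 8 / pi) / (2 * real n) * exp (2 * sqrt (pi\<^sup>2 / 8 * real n)))
     = (\<lambda>n. 3 * exp (pi * sqrt (real n / 2)) / (4 * sqrt 2 * real n))"
  proof
    fix n :: nat
    have s8: "sqrt 8 = 2 * sqrt 2" using real_sqrt_mult[of 4 2] by simp
    have e: "pi\<^sup>2 / 8 / pi = pi / 8" by (simp add: power2_eq_square)
    have 1: "sqrt (pi\<^sup>2 / 8 / pi) = sqrt pi / (2 * sqrt 2)" unfolding e real_sqrt_divide s8 ..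
    have "sqrt (pi\<^sup>2 / 8 * real n) = sqrt ((pi / 2)\<^sup>2 * (real n / 2))"
      by (simp add: power_divide)
    also have "\<dots> = pi / 2 * sqrt (real n / 2)" unfolding real_sqrt_mult by simp
    finally have 2: "2 * sqrt (pi\<^sup>2 / 8 * real n) = pi * sqrt (real n / 2)" by simp
    show "3 / sqrt pi * sqrt (pi\<^sup>2 / 8 / pi) / (2 * real n) * exp (2 * sqrt (pi\<^sup>2 / 8 * real n))
        = 3 * exp (pi * sqrt (real n / 2)) / (4 * sqrt 2 * real n)"
      unfolding 1 2 by simp
  qed
  finally show ?thesis .
qed

end
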